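(* Let $n\ge 5$ and let $T$ be a $2$-triangulation of the convex $n$-gon, viewed as a graph on the vertex set $\{0,1,\dots,n-1\}$ (with all its edges, including those of length at most $2$). Then $T$ is generically minimally rigid in dimension $4$: for a generic embedding of its vertices in $\mathbb{R}^4$ the resulting bar-and-joint framework is rigid, and removing any single edge of $T$ yields a graph that is generically flexible in $\mathbb{R}^4$.
   Context: Let $V_n=\{0,\dots,n-1\}$ be the vertices of a convex $n$-gon in cyclic order and $E_n$ the set of all $\binom n2$ segments $[u,v]$ between them. Two edges cross if their four endpoints are distinct and alternate in the cyclic order. An $\ell$-crossing is a set of $\ell$ pairwise crossing edges. A $k$-triangulation of the $n$-gon is a maximal subset of $E_n$ containing no $(k+1)$-crossing. A $d$-dimensional framework is a graph with an embedding of its vertices in $\mathbb{R}^d$ (edges as rigid bars); it is rigid if every continuous motion of the vertices preserving all edge lengths is induced by an isometry of $\mathbb{R}^d$, and flexible otherwise. A graph is generically rigid (resp. flexible) in dimension $d$ if its embeddings in general position in $\mathbb{R}^d$ are rigid (resp. flexible); it is generically minimally rigid if it is generically rigid and deleting any edge makes it generically flexible. *)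

theory Defs
  imports "HOL-Analysis.Analysis" "HOL-Library.Poly_Mapping"
begin

definition polygon_edges :: "nat \<Rightarrow> nat set set" where
  "polygon_edges n = {{u, v} |u v. u < n \<and> v < n \<and> u \<noteq> v}"

text \<open>
  The cyclic order on the vertices is the natural order with its ends joined, so the
  endpoints of two edges alternate cyclically iff they alternate in the natural order.
\<close>
definition edges_cross :: "nat set \<Rightarrow> nat set \<Rightarrow> bool" where
  "edges_cross e f \<longleftrightarrow>
     (\<exists>a b c d. a < b \<and> b < c \<and> c < d \<and>
        (e = {a, c} \<and> f = {b, d} \<or> e = {b, d} \<and> f = {a, c}))"

definition crossing :: "nat \<Rightarrow> nat set set \<Rightarrow> bool" where
  "crossing l C \<longleftrightarrow> finite C \<and> card C = l \<and> pairwise edges_cross C"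

definition crossing_free :: "nat \<Rightarrow> nat set set \<Rightarrow> bool" where
  "crossing_free l T \<longleftrightarrow> \<not> (\<exists>C \<subseteq> T. crossing l C)"

definition k_triangulation :: "nat \<Rightarrow> nat \<Rightarrow> nat set set \<Rightarrow> bool" where
  "k_triangulation k n T \<longleftrightarrow>
     T \<subseteq> polygon_edges n \<and> crossing_free (k + 1) T \<and>
     (\<forall>T'. T \<subset> T' \<and> T' \<subseteq> polygon_edges n \<longrightarrow> \<not> crossing_free (k + 1) T')"

text \<open>
  In a framework only the values of the embedding on the vertex set \<open>V\<close> matter.
  A motion is parametrised by the time interval \<open>{0..1}\<close> and starts at \<open>p\<close>.
\<close>
definition framework_motion ::
  "'v set \<Rightarrow> 'v set set \<Rightarrow> ('v \<Rightarrow> real ^ 'd) \<Rightarrow> (real \<Rightarrow> 'v \<Rightarrow> real ^ 'd) \<Rightarrow> bool" where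
  "framework_motion V E p q \<longleftrightarrow>
     (\<forall>v\<in>V. continuous_on {0..1} (\<lambda>t. q t v)) \<and>
     (\<forall>v\<in>V. q 0 v = p v) \<and>
     (\<forall>t\<in>{0..1}. \<forall>u\<in>V. \<forall>v\<in>V. {u, v} \<in> E \<longrightarrow> dist (q t u) (q t v) = dist (p u) (p v))"

definition euclidean_isometry :: "(real ^ 'd \<Rightarrow> real ^ 'd) \<Rightarrow> bool" where
  "euclidean_isometry h \<longleftrightarrow> bij h \<and> (\<forall>x y. dist (h x) (h y) = dist x y)"

definition rigid_framework ::
  "'v set \<Rightarrow> 'v set set \<Rightarrow> ('v \<Rightarrow> real ^ 'd) \<Rightarrow> bool" where
  "rigid_framework V E p \<longleftrightarrow>
     (\<forall>q. framework_motion V E p q \<longrightarrow>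
        (\<forall>t\<in>{0..1}. \<exists>h. euclidean_isometry h \<and> (\<forall>v\<in>V. q t v = h (p v))))"

abbreviation flexible_framework ::
  "'v set \<Rightarrow> 'v set set \<Rightarrow> ('v \<Rightarrow> real ^ 'd) \<Rightarrow> bool" where
  "flexible_framework V E p \<equiv> \<not> rigid_framework V E p"

text \<open>
  An element of \<open>('i \<Rightarrow>\<^sub>0 nat) \<Rightarrow>\<^sub>0 rat\<close> is a polynomial with rational
  coefficients in variables indexed by \<open>'i\<close>: it maps each monomial (an exponent vector
  of finite support) to its coefficient.
\<close>
definition eval_rat_mpoly :: "(('i \<Rightarrow>\<^sub>0 nat) \<Rightarrow>\<^sub>0 rat) \<Rightarrow> ('i \<Rightarrow> real) \<Rightarrow> real" where
  "eval_rat_mpoly P x =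
     (\<Sum>m\<in>Poly_Mapping.keys P.
        of_rat (Poly_Mapping.lookup P m) *
        (\<Prod>i\<in>Poly_Mapping.keys m. x i ^ Poly_Mapping.lookup m i))"

definition algebraically_independent :: "'i set \<Rightarrow> ('i \<Rightarrow> real) \<Rightarrow> bool" where
  "algebraically_independent I x \<longleftrightarrow>
     (\<forall>P. (\<forall>m\<in>Poly_Mapping.keys P. Poly_Mapping.keys m \<subseteq> I) \<and> eval_rat_mpoly P x = 0
        \<longrightarrow> P = 0)"

text \<open>
  An embedding is generic if the family of all \<open>card V * CARD('d)\<close> coordinates of its
  points is algebraically independent over the rationals.
\<close>
definition generic_embedding :: "'v set \<Rightarrow> ('v \<Rightarrow> real ^ 'd) \<Rightarrow> bool" where
  "generic_embedding V p \<longleftrightarrow>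
     algebraically_independent (V \<times> (UNIV :: 'd set)) (\<lambda>(v, i). p v $ i)"

text \<open>The dimension is passed as the index type \<open>'d\<close> of \<open>real ^ 'd\<close>.\<close>
definition generically_rigid :: "'d::finite itself \<Rightarrow> 'v set \<Rightarrow> 'v set set \<Rightarrow> bool" where
  "generically_rigid _ V E \<longleftrightarrow>
     (\<forall>p :: 'v \<Rightarrow> real ^ 'd. generic_embedding V p \<longrightarrow> rigid_framework V E p)"

definition generically_flexible :: "'d::finite itself \<Rightarrow> 'v set \<Rightarrow> 'v set set \<Rightarrow> bool" where
  "generically_flexible _ V E \<longleftrightarrow>
     (\<forall>p :: 'v \<Rightarrow> real ^ 'd. generic_embedding V p \<longrightarrow> flexible_framework V E p)"

definition generically_minimally_rigid ::
  "'d::finite itself \<Rightarrow> 'v set \<Rightarrow> 'v set set \<Rightarrow> bool" where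
  "generically_minimally_rigid D V E \<longleftrightarrow>
     generically_rigid D V E \<and> (\<forall>e\<in>E. generically_flexible D V (E - {e}))"

end

theory Submission
  imports Defs "Jordan_Normal_Form.Determinant"
begin

text \<open>
  A 2-triangulation of an \<open>n\<close>-gon with \<open>n \<ge> 6\<close> has an edge of length 3. Contracting
  the middle edge of the path of boundary edges that it cuts off gives a 2-triangulation of the
  \<open>(n - 1)\<close>-gon, and the two glued vertices have exactly three common neighbours. Hence the
  triangulation arises from the complete graph on five vertices by vertex splits on
  \<open>3 = 4 - 1\<close> edges. Each split adds four edges and preserves infinitesimal rigidity in
  dimension 4, so there are \<open>4 n - 10\<close> edges and a square rigidity system which is
  nonsingular for some position. Its determinant is a rational polynomial in the coordinates,
  so it does not vanish at a generic position. Infinitesimal rigidity implies rigidity by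
  averaging two congruent frameworks; independence of the edges allows one to change the length
  of a single edge while fixing all the others, which is a flex once that edge is deleted.
\<close>

subsection \<open>Square linear systems\<close>

text \<open>In dimension 4 the difference of the velocities of the two glued vertices has four
  coordinates. Three common neighbours give three linear conditions on it, and the direction of the
  collapsed edge gives the fourth. Fewer common neighbours would leave the difference undetermined;
  more would spoil the edge count. The 10 in \<open>4 n - 10\<close> is the dimension of the
  isometry group of 4-space. Ten normalising equations therefore make the system square, and one
  determinant serves three purposes: by continuity it survives small displacements, as a rational
  polynomial it carries a single good position over to all generic ones, and through the inverse
  matrix it allows edge lengths to be prescribed independently. Minimality thus comes from the same
  nonsingularity as rigidity. On the combinatorial side the obstacle is that the contracted graph
  must again be maximal. A missing edge has to be lifted through the contraction together with the
  two edges that block it; an edge at the glued vertex has two lifts, and only one of them is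
  suitable.\<close>

definition leibniz :: "nat \<Rightarrow> (nat \<Rightarrow> nat \<Rightarrow> real) \<Rightarrow> real" where
  "leibniz n N = (\<Sum>\<pi> | \<pi> permutes {0..<n}. of_int (sign \<pi>) * (\<Prod>i = 0..<n. N i (\<pi> i)))"

text \<open>Bridge to the matrix library, which supplies the kernel criterion and the inverse.
  Elsewhere the explicit sum of products is used, since its continuity and polynomiality in the
  entries are immediate.\<close>

lemma leibniz_eq_det: "leibniz n N = Determinant.det (mat n n (\<lambda>(i, j). N i j))"
proof -
  have "(\<Prod>i = 0..<n. mat n n (\<lambda>(i, j). N i j) $$ (i, \<pi> i)) = (\<Prod>i = 0..<n. N i (\<pi> i))"
    if "\<pi> permutes {0..<n}" for \<pi>
    using that by (intro prod.cong) (auto dest: permutes_in_image)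
  then show ?thesis
    unfolding leibniz_def by (subst det_def'[of _ n]) (auto intro!: sum.cong)
qed

lemma leibniz_eq_0_iff:
  "leibniz n N = 0 \<longleftrightarrow> (\<exists>v. (\<exists>j<n. v j \<noteq> 0) \<and> (\<forall>i<n. (\<Sum>j<n. N i j * v j) = 0))"
proof -
  let ?A = "mat n n (\<lambda>(i, j). N i j)"
  have A: "?A \<in> carrier_mat n n" by simp
  have *: "vec_index (?A *\<^sub>v u) i = (\<Sum>j<n. N i j * vec_index u j)" if "i < n" "u \<in> carrier_vec n" for u i
    using that by (auto simp: scalar_prod_def atLeast0LessThan intro!: sum.cong)
  show ?thesis
    unfolding leibniz_eq_det det_0_iff_vec_prod_zero_field[OF A]
  proof safe
    fix u :: "real Matrix.vec" assume u: "u \<in> carrier_vec n" "u \<noteq> 0\<^sub>v n" "?A *\<^sub>v u = 0\<^sub>v n"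
    then obtain j where "j < n" "vec_index u j \<noteq> 0" by (metis carrier_vecD eq_vecI index_zero_vec)
    moreover have "(\<Sum>j<n. N i j * vec_index u j) = 0" if "i < n" for i
      using *[OF that u(1)] u(3) that by simp
    ultimately show "\<exists>v. (\<exists>j<n. v j \<noteq> 0) \<and> (\<forall>i<n. (\<Sum>j<n. N i j * v j) = 0)" by blast
  next
    fix v j assume v: "j < n" "v j \<noteq> 0" "\<forall>i<n. (\<Sum>j<n. N i j * v j) = 0"
    let ?u = "Matrix.vec n v"
    have "?u \<noteq> 0\<^sub>v n" using v(1,2) by (metis index_vec index_zero_vec(1))
    moreover have "?A *\<^sub>v ?u = 0\<^sub>v n"
    proof (rule eq_vecI)
      fix i assume "i < dim_vec (0\<^sub>v n :: real Matrix.vec)"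
      then have i: "i < n" by simp
      show "vec_index (?A *\<^sub>v ?u) i = vec_index (0\<^sub>v n) i"
        using v(3) i *[OF i, of ?u] by (simp del: index_mult_mat_vec)
    qed simp
    ultimately show "\<exists>u. u \<in> carrier_vec n \<and> u \<noteq> 0\<^sub>v n \<and> ?A *\<^sub>v u = 0\<^sub>v n"
      by (intro exI[of _ ?u]) simp
  qed
qed

lemma leibniz_right_inverse:
  assumes "leibniz n N \<noteq> 0"
  shows "\<exists>B. \<forall>i<n. \<forall>k<n. (\<Sum>j<n. N i j * B j k) = (if i = k then 1 else 0)"
proof -
  let ?A = "mat n n (\<lambda>(i, j). N i j)"
  have "?A \<in> Units (ring_mat TYPE(real) n b)" for b :: unit
    using assms by (intro det_non_zero_imp_unit) (auto simp: leibniz_eq_det)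
  then obtain B where B: "B \<in> carrier_mat n n" "?A * B = 1\<^sub>m n"
    unfolding Units_def ring_mat_def by auto
  have "(\<Sum>j<n. N i j * B $$ (j, k)) = (if i = k then 1 else 0)" if "i < n" "k < n" for i k
  proof -
    have "(?A * B) $$ (i, k) = (\<Sum>j<n. N i j * B $$ (j, k))"
      using B(1) that by (auto simp: scalar_prod_def atLeast0LessThan intro!: sum.cong)
    then show ?thesis using B(2) that by simp
  qed
  then show ?thesis by (intro exI[of _ "\<lambda>j k. B $$ (j, k)"]) blast
qed

no_notation vec_index (infixl "$" 100)
no_notation scalar_prod (infix "\<bullet>" 70)

text \<open>Trivial kernel, with rows and columns indexed by arbitrary sets. For finite sets of
  equal cardinality it means a nonzero determinant under any enumerations, so edges and coordinates
  never have to be numbered by hand.\<close>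

definition nonsing :: "'r set \<Rightarrow> 'c set \<Rightarrow> ('r \<Rightarrow> 'c \<Rightarrow> real) \<Rightarrow> bool" where
  "nonsing R C M \<longleftrightarrow> (\<forall>d. (\<forall>r\<in>R. (\<Sum>c\<in>C. M r c * d c) = 0) \<longrightarrow> (\<forall>c\<in>C. d c = 0))"

lemma nonsing_leibniz:
  assumes f: "bij_betw f {..<n} R" and g: "bij_betw g {..<n} C"
  shows "nonsing R C M \<longleftrightarrow> leibniz n (\<lambda>i j. M (f i) (g j)) \<noteq> 0"
proof -
  have sum: "(\<Sum>c\<in>C. M r c * d c) = (\<Sum>j<n. M r (g j) * d (g j))" for r d
    using sum.reindex_bij_betw[OF g, of "\<lambda>c. M r c * d c"] by simp
  have R: "R = f ` {..<n}" and C: "C = g ` {..<n}" using f g by (auto simp: bij_betw_def)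
  have inj: "inj_on g {..<n}" using g by (auto simp: bij_betw_def)
  show ?thesis
    unfolding leibniz_eq_0_iff nonsing_def sum
  proof safe
    fix v j
    assume *: "\<forall>d. (\<forall>r\<in>R. (\<Sum>j<n. M r (g j) * d (g j)) = 0) \<longrightarrow> (\<forall>c\<in>C. d c = 0)"
      "j < n" "v j \<noteq> 0" "\<forall>i<n. (\<Sum>j<n. M (f i) (g j) * v j) = 0"
    let ?d = "\<lambda>c. v (the_inv_into {..<n} g c)"
    have d: "?d (g j) = v j" if "j < n" for j using the_inv_into_f_f[OF inj] that by simp
    have "\<forall>r\<in>R. (\<Sum>j<n. M r (g j) * ?d (g j)) = 0"
      using *(4) d unfolding R by auto
    then have "\<forall>c\<in>C. ?d c = 0" using *(1)[rule_format, of ?d] by blast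
    then have "?d (g j) = 0" using *(2) C by blast
    then show False using d *(2,3) by simp
  next
    fix d c
    assume *: "\<nexists>v. (\<exists>j<n. v j \<noteq> 0) \<and> (\<forall>i<n. (\<Sum>j<n. M (f i) (g j) * v j) = 0)"
      "\<forall>r\<in>R. (\<Sum>j<n. M r (g j) * d (g j)) = 0" "c \<in> C"
    have "\<forall>i<n. (\<Sum>j<n. M (f i) (g j) * d (g j)) = 0" using *(2) R by auto
    then have "\<forall>j<n. d (g j) = 0" using *(1)[unfolded not_ex, rule_format, of "\<lambda>j. d (g j)"] by blast
    then show "d c = 0" using *(3) C by auto
  qed
qed

lemma square_enumeration:
  assumes "finite R" "finite C" "card R = card C"
  obtains f g n where "bij_betw f {..<n::nat} R" "bij_betw g {..<n} C"
  using assms ex_bij_betw_nat_finite[of R] ex_bij_betw_nat_finite[of C] by (auto simp: atLeast0LessThan)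

lemma nonsing_right_inverse:
  assumes "finite R" "finite C" "card R = card C" "nonsing R C M"
  shows "\<exists>L. \<forall>y. \<forall>r\<in>R. (\<Sum>c\<in>C. M r c * (\<Sum>r'\<in>R. L c r' * y r')) = y r"
proof -
  obtain f g n where f: "bij_betw f {..<n::nat} R" and g: "bij_betw g {..<n} C"
    using square_enumeration[OF assms(1-3)] by blast
  obtain B where B: "(\<Sum>j<n. M (f i) (g j) * B j k) = (if i = k then 1 else 0)" if "i < n" "k < n" for i k
    using leibniz_right_inverse[of n "\<lambda>i j. M (f i) (g j)"] assms(4) nonsing_leibniz[OF f g] by auto
  define L where "L c r = B (the_inv_into {..<n} g c) (the_inv_into {..<n} f r)" for c r
  have L: "L (g j) (f k) = B j k" if "j < n" "k < n" for j k
    using f g that by (simp add: L_def bij_betw_def the_inv_into_f_f)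
  have "(\<Sum>c\<in>C. M r c * (\<Sum>r'\<in>R. L c r' * y r')) = y r" if r: "r \<in> R" for y r
  proof -
    obtain i where i: "i < n" "r = f i" using r f by (auto simp: bij_betw_def)
    have "(\<Sum>c\<in>C. M r c * (\<Sum>r'\<in>R. L c r' * y r')) = (\<Sum>j<n. M (f i) (g j) * (\<Sum>k<n. B j k * y (f k)))"
      unfolding sum.reindex_bij_betw[OF g, symmetric] sum.reindex_bij_betw[OF f, symmetric] i(2)
      by (intro sum.cong refl arg_cong2[where f = "(*)"]) (auto simp: L)
    also have "\<dots> = (\<Sum>k<n. (\<Sum>j<n. M (f i) (g j) * B j k) * y (f k))"
      unfolding sum_distrib_left sum_distrib_right by (subst sum.swap) (simp add: mult_ac)
    also have "\<dots> = (\<Sum>k<n. if i = k then y (f k) else 0)"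
      using i by (intro sum.cong) (auto simp: B)
    also have "\<dots> = y r" using i by simp
    finally show ?thesis .
  qed
  then show ?thesis by blast
qed

text \<open>The determinant is continuous in the entries. The filter \<open>at s within S\<close>
  covers both a free real parameter and a time restricted to \<open>{0..1}\<close>.\<close>

lemma nonsing_open:
  fixes M :: "'a::topological_space \<Rightarrow> 'r \<Rightarrow> 'c \<Rightarrow> real"
  assumes "finite R" "finite C" "card R = card C" "nonsing R C (M s)"
    and cont: "\<And>r c. r \<in> R \<Longrightarrow> c \<in> C \<Longrightarrow> ((\<lambda>s. M s r c) \<longlongrightarrow> M s r c) (at s within S)"
  shows "\<forall>\<^sub>F t in at s within S. nonsing R C (M t)"
proof -
  obtain f g n where f: "bij_betw f {..<n::nat} R" and g: "bij_betw g {..<n} C"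
    using square_enumeration[OF assms(1-3)] by blast
  have "((\<lambda>t. leibniz n (\<lambda>i j. M t (f i) (g j))) \<longlongrightarrow> leibniz n (\<lambda>i j. M s (f i) (g j))) (at s within S)"
    unfolding leibniz_def
  proof (intro tendsto_intros)
    fix \<pi> i assume "\<pi> \<in> {\<pi>. \<pi> permutes {0..<n}}" "i \<in> {0..<n}"
    then have "\<pi> i < n" "i < n" using permutes_in_image by fastforce+
    then show "((\<lambda>t. M t (f i) (g (\<pi> i))) \<longlongrightarrow> M s (f i) (g (\<pi> i))) (at s within S)"
      using f g by (intro cont) (auto simp: bij_betw_def)
  qed
  from tendsto_imp_eventually_ne[OF this] show ?thesis
    using assms(4) unfolding nonsing_leibniz[OF f g] by auto
qed

subsection \<open>Polynomial functions and genericity\<close>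

definition polyfun :: "'i set \<Rightarrow> (('i \<Rightarrow> real) \<Rightarrow> real) \<Rightarrow> bool" where
  "polyfun I f \<longleftrightarrow>
     (\<exists>P. (\<forall>m\<in>Poly_Mapping.keys P. Poly_Mapping.keys m \<subseteq> I) \<and> (\<forall>x. eval_rat_mpoly P x = f x))"

definition eval_monom :: "('i \<Rightarrow>\<^sub>0 nat) \<Rightarrow> ('i \<Rightarrow> real) \<Rightarrow> real" where
  "eval_monom m x = (\<Prod>i\<in>Poly_Mapping.keys m. x i ^ Poly_Mapping.lookup m i)"

lemma eval_monom_superset:
  assumes "finite A" "Poly_Mapping.keys m \<subseteq> A"
  shows "eval_monom m x = (\<Prod>i\<in>A. x i ^ Poly_Mapping.lookup m i)"
  unfolding eval_monom_def using assms
  by (intro prod.mono_neutral_left) (auto simp: in_keys_iff)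

lemma eval_monom_add: "eval_monom (m + m') x = eval_monom m x * eval_monom m' x"
proof -
  let ?A = "Poly_Mapping.keys m \<union> Poly_Mapping.keys m'"
  show ?thesis
    using keys_add[of m m']
    by (simp add: eval_monom_superset[of ?A] lookup_add power_add prod.distrib)
qed

lemma eval_rat_mpoly_superset:
  assumes "finite A" "Poly_Mapping.keys P \<subseteq> A"
  shows "eval_rat_mpoly P x = (\<Sum>m\<in>A. of_rat (Poly_Mapping.lookup P m) * eval_monom m x)"
  unfolding eval_rat_mpoly_def eval_monom_def[symmetric] using assms
  by (intro sum.mono_neutral_left) (auto simp: in_keys_iff)

lemma eval_rat_mpoly_add: "eval_rat_mpoly (P + Q) x = eval_rat_mpoly P x + eval_rat_mpoly Q x"
proof -
  let ?A = "Poly_Mapping.keys P \<union> Poly_Mapping.keys Q"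
  show ?thesis
    using keys_add[of P Q]
    by (simp add: eval_rat_mpoly_superset[of ?A] lookup_add of_rat_add distrib_right sum.distrib)
qed

lemma eval_rat_mpoly_zero: "eval_rat_mpoly 0 x = 0"
  by (simp add: eval_rat_mpoly_def)

lemma eval_rat_mpoly_single: "eval_rat_mpoly (Poly_Mapping.single m a) x = of_rat a * eval_monom m x"
  by (cases "a = 0") (simp_all add: eval_rat_mpoly_def eval_monom_def)

lemma eval_rat_mpoly_sum: "eval_rat_mpoly (sum F A) x = (\<Sum>a\<in>A. eval_rat_mpoly (F a) x)"
  by (induction A rule: infinite_finite_induct) (simp_all add: eval_rat_mpoly_add eval_rat_mpoly_zero)

lemma poly_mapping_eq_sum_single:
  "P = (\<Sum>m\<in>Poly_Mapping.keys P. Poly_Mapping.single m (Poly_Mapping.lookup P m))"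
  by (rule poly_mapping_eqI)
    (auto simp: lookup_sum lookup_single when_def in_keys_iff sum.delta)

lemma eval_rat_mpoly_mult: "eval_rat_mpoly (P * Q) x = eval_rat_mpoly P x * eval_rat_mpoly Q x"
proof -
  have "eval_rat_mpoly (P * Q) x =
    eval_rat_mpoly ((\<Sum>m\<in>Poly_Mapping.keys P. Poly_Mapping.single m (Poly_Mapping.lookup P m)) *
      (\<Sum>m\<in>Poly_Mapping.keys Q. Poly_Mapping.single m (Poly_Mapping.lookup Q m))) x"
    using poly_mapping_eq_sum_single[of P] poly_mapping_eq_sum_single[of Q] by simp
  also have "\<dots> = eval_rat_mpoly P x * eval_rat_mpoly Q x"
    by (simp add: sum_product mult_single eval_rat_mpoly_sum eval_rat_mpoly_single eval_monom_add of_rat_mult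
        eval_rat_mpoly_superset[of "Poly_Mapping.keys P" P] eval_rat_mpoly_superset[of "Poly_Mapping.keys Q" Q] mult_ac)
  finally show ?thesis .
qed

lemma polyfun_const: "polyfun I (\<lambda>x. of_rat a)"
  unfolding polyfun_def
  by (intro exI[of _ "Poly_Mapping.single 0 a"]) (simp add: eval_rat_mpoly_single eval_monom_def)

lemma polyfun_var: "i \<in> I \<Longrightarrow> polyfun I (\<lambda>x. x i)"
  unfolding polyfun_def
  by (intro exI[of _ "Poly_Mapping.single (Poly_Mapping.single i 1) 1"])
    (simp add: eval_rat_mpoly_single eval_monom_def)

lemma polyfun_add:
  assumes "polyfun I f" "polyfun I g"
  shows "polyfun I (\<lambda>x. f x + g x)"
proof -
  obtain P Q where "\<forall>m\<in>Poly_Mapping.keys P. Poly_Mapping.keys m \<subseteq> I" "\<forall>x. eval_rat_mpoly P x = f x"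
    "\<forall>m\<in>Poly_Mapping.keys Q. Poly_Mapping.keys m \<subseteq> I" "\<forall>x. eval_rat_mpoly Q x = g x"
    using assms unfolding polyfun_def by blast
  then show ?thesis
    unfolding polyfun_def using subsetD[OF keys_add[of P Q]]
    by (intro exI[of _ "P + Q"]) (simp add: eval_rat_mpoly_add, blast)
qed

lemma polyfun_mult:
  assumes "polyfun I f" "polyfun I g"
  shows "polyfun I (\<lambda>x. f x * g x)"
proof -
  obtain P Q where PQ: "\<forall>m\<in>Poly_Mapping.keys P. Poly_Mapping.keys m \<subseteq> I" "\<forall>x. eval_rat_mpoly P x = f x"
    "\<forall>m\<in>Poly_Mapping.keys Q. Poly_Mapping.keys m \<subseteq> I" "\<forall>x. eval_rat_mpoly Q x = g x"
    using assms unfolding polyfun_def by blast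
  have "Poly_Mapping.keys m \<subseteq> I" if m: "m \<in> Poly_Mapping.keys (P * Q)" for m
  proof -
    obtain a b where "a \<in> Poly_Mapping.keys P" "b \<in> Poly_Mapping.keys Q" "m = a + b"
      using keys_mult[of P Q] m by blast
    then show ?thesis using PQ(1,3) keys_add[of a b] by blast
  qed
  then show ?thesis
    unfolding polyfun_def using PQ(2,4) by (intro exI[of _ "P * Q"]) (auto simp: eval_rat_mpoly_mult)
qed

lemma polyfun_0: "polyfun I (\<lambda>x. 0)"
  using polyfun_const[of I 0] by simp

lemma polyfun_of_int: "polyfun I (\<lambda>x. of_int k)"
  using polyfun_const[of I "of_int k"] by simp

lemma polyfun_uminus: "polyfun I f \<Longrightarrow> polyfun I (\<lambda>x. - f x)"
  using polyfun_mult[OF polyfun_of_int[of I "-1"]] by simp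

lemma polyfun_minus: "polyfun I f \<Longrightarrow> polyfun I g \<Longrightarrow> polyfun I (\<lambda>x. f x - g x)"
  using polyfun_add[OF _ polyfun_uminus] by fastforce

lemma polyfun_sum: "(\<And>a. a \<in> A \<Longrightarrow> polyfun I (f a)) \<Longrightarrow> polyfun I (\<lambda>x. \<Sum>a\<in>A. f a x)"
  by (induction A rule: infinite_finite_induct) (simp_all add: polyfun_0 polyfun_add)

lemma polyfun_prod: "(\<And>a. a \<in> A \<Longrightarrow> polyfun I (f a)) \<Longrightarrow> polyfun I (\<lambda>x. \<Prod>a\<in>A. f a x)"
  using polyfun_of_int[of I 1]
  by (induction A rule: infinite_finite_induct) (simp_all add: polyfun_mult)

lemma polyfun_if:
  "(b \<Longrightarrow> polyfun I f) \<Longrightarrow> (\<not> b \<Longrightarrow> polyfun I g) \<Longrightarrow> polyfun I (\<lambda>x. if b then f x else g x)"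
  by (cases b) simp_all

text \<open>If \<open>f x = 0\<close>, independence makes the representing polynomial zero, so
  \<open>f\<close> vanishes at \<open>y\<close> too. The point \<open>y\<close> may have any real
  coordinates: one good position, however obtained, decides all generic ones.\<close>

lemma polyfun_nonzero_at_independent:
  assumes "algebraically_independent I x" "polyfun I f" "f y \<noteq> 0"
  shows "f x \<noteq> 0"
  using assms eval_rat_mpoly_zero unfolding algebraically_independent_def polyfun_def by metis

lemma nonsing_generic:
  assumes "finite R" "finite C" "card R = card C" "nonsing R C (M y)"
    and "algebraically_independent I x"
    and poly: "\<And>r c. r \<in> R \<Longrightarrow> c \<in> C \<Longrightarrow> polyfun I (\<lambda>x. M x r c)"
  shows "nonsing R C (M x)"
proof -
  obtain f g n where f: "bij_betw f {..<n::nat} R" and g: "bij_betw g {..<n} C"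
    using square_enumeration[OF assms(1-3)] by blast
  have "polyfun I (\<lambda>x. leibniz n (\<lambda>i j. M x (f i) (g j)))"
    unfolding leibniz_def
  proof (intro polyfun_sum polyfun_mult polyfun_of_int polyfun_prod poly)
    fix \<pi> i assume "\<pi> \<in> {\<pi>. \<pi> permutes {0..<n}}" "i \<in> {0..<n}"
    then have "\<pi> i < n" "i < n" using permutes_in_image by fastforce+
    then show "f i \<in> R" "g (\<pi> i) \<in> C" using f g by (auto simp: bij_betw_def)
  qed
  from polyfun_nonzero_at_independent[OF assms(5) this, of y] show ?thesis
    using assms(4) unfolding nonsing_leibniz[OF f g] by simp
qed

subsection \<open>Crossings, ears and rotations\<close>

lemma edges_cross_pair:
  "edges_cross {i, j} {k, l} \<longleftrightarrow>
     i < k \<and> k < j \<and> j < l \<or> i < l \<and> l < j \<and> j < k \<or>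
     j < k \<and> k < i \<and> i < l \<or> j < l \<and> l < i \<and> i < k \<or>
     k < i \<and> i < l \<and> l < j \<or> k < j \<and> j < l \<and> l < i \<or>
     l < i \<and> i < k \<and> k < j \<or> l < j \<and> j < k \<and> k < i"
  (is "?L \<longleftrightarrow> ?R")
proof
  assume ?L
  then show ?R unfolding edges_cross_def doubleton_eq_iff by (elim exE conjE disjE) simp_all
next
  assume ?R
  moreover have "edges_cross {a, c} {b, d} \<and> edges_cross {c, a} {b, d} \<and>
      edges_cross {a, c} {d, b} \<and> edges_cross {c, a} {d, b} \<and>
      edges_cross {b, d} {a, c} \<and> edges_cross {b, d} {c, a} \<and>
      edges_cross {d, b} {a, c} \<and> edges_cross {d, b} {c, a}"
    if "a < b" "b < c" "c < d" for a b c d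
    unfolding insert_commute[of c a] insert_commute[of d b] using that
    unfolding edges_cross_def by blast
  ultimately show ?L by blast
qed

lemma edges_cross_ordered:
  assumes "i < j" "k < l"
  shows "edges_cross {i, j} {k, l} \<longleftrightarrow> i < k \<and> k < j \<and> j < l \<or> k < i \<and> i < l \<and> l < j"
  using assms unfolding edges_cross_pair by auto

lemma edges_cross_sym: "edges_cross e f \<longleftrightarrow> edges_cross f e"
  unfolding edges_cross_def by blast

lemma edges_cross_irrefl: "\<not> edges_cross e e"
  unfolding edges_cross_def doubleton_eq_iff by auto

lemma polygon_edgesE:
  assumes "e \<in> polygon_edges n"
  obtains i j where "e = {i, j}" "i < j" "j < n"
proof -
  obtain u v where "e = {u, v}" "u < n" "v < n" "u \<noteq> v"
    using assms unfolding polygon_edges_def by blast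
  then show thesis using that[of u v] that[of v u] by (cases "u < v") (auto simp: insert_commute)
qed

lemma polygon_edge_pairE:
  assumes "e \<in> polygon_edges n" "f \<in> polygon_edges n"
  obtains i j k l where "e = {i, j}" "i < j" "j < n" "f = {k, l}" "k < l" "l < n"
  using polygon_edgesE[OF assms(1)] polygon_edgesE[OF assms(2)] by metis

lemma polygon_edge_iff: "{u, v} \<in> polygon_edges n \<longleftrightarrow> u < n \<and> v < n \<and> u \<noteq> v"
  unfolding polygon_edges_def by (auto simp: doubleton_eq_iff)

lemma finite_polygon_edges: "finite (polygon_edges n)"
  by (rule finite_subset[of _ "Pow {..<n}"]) (auto simp: polygon_edges_def)

lemma crossing_free_3_iff:
  "crossing_free 3 T \<longleftrightarrow>
     \<not> (\<exists>e\<in>T. \<exists>f\<in>T. \<exists>g\<in>T. edges_cross e f \<and> edges_cross e g \<and> edges_cross f g)"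
proof -
  have "(\<exists>C\<subseteq>T. crossing 3 C) \<longleftrightarrow>
     (\<exists>e\<in>T. \<exists>f\<in>T. \<exists>g\<in>T. edges_cross e f \<and> edges_cross e g \<and> edges_cross f g)"
  proof safe
    fix C assume C: "C \<subseteq> T" "crossing 3 C"
    then obtain e f g where "C = {e, f, g}" "e \<noteq> f" "e \<noteq> g" "f \<noteq> g"
      unfolding crossing_def by (metis card_3_iff)
    then show "\<exists>e\<in>T. \<exists>f\<in>T. \<exists>g\<in>T. edges_cross e f \<and> edges_cross e g \<and> edges_cross f g"
      using C unfolding crossing_def pairwise_def by (metis insert_iff subset_eq)
  next
    fix e f g assume *: "e \<in> T" "f \<in> T" "g \<in> T" "edges_cross e f" "edges_cross e g" "edges_cross f g"
    then have "e \<noteq> f" "e \<noteq> g" "f \<noteq> g" using edges_cross_irrefl by blast+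
    then have "crossing 3 {e, f, g}"
      unfolding crossing_def pairwise_def using * edges_cross_sym by auto
    then show "\<exists>C\<subseteq>T. crossing 3 C" using * by (intro exI[of _ "{e, f, g}"]) simp
  qed
  then show ?thesis unfolding crossing_free_def by simp
qed

text \<open>Crossing-freeness passes to subsets, so maximality may be tested by adding single edges.
  A 3-crossing that appears must contain the added edge, because \<open>T\<close> has none; this
  yields the two blocking edges \<open>f\<close> and \<open>g\<close>.\<close>

lemma triangulation_iff:
  "k_triangulation 2 n T \<longleftrightarrow>
     T \<subseteq> polygon_edges n \<and>
     (\<forall>e\<in>T. \<forall>f\<in>T. \<forall>g\<in>T. \<not> (edges_cross e f \<and> edges_cross e g \<and> edges_cross f g)) \<and>
     (\<forall>e\<in>polygon_edges n. e \<notin> T \<longrightarrow>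
        (\<exists>f\<in>T. \<exists>g\<in>T. edges_cross e f \<and> edges_cross e g \<and> edges_cross f g))"
    (is "_ \<longleftrightarrow> _ \<and> ?F \<and> ?M")
proof -
  have three: "(2::nat) + 1 = 3" by simp
  have F: "crossing_free (2 + 1) T \<longleftrightarrow>
    (\<forall>e\<in>T. \<forall>f\<in>T. \<forall>g\<in>T. \<not> (edges_cross e f \<and> edges_cross e g \<and> edges_cross f g))" for T
    unfolding three crossing_free_3_iff by meson
  have "(\<forall>T'. T \<subset> T' \<and> T' \<subseteq> polygon_edges n \<longrightarrow> \<not> crossing_free (2 + 1) T') \<longleftrightarrow> ?M"
    if T: "T \<subseteq> polygon_edges n" "?F"
  proof (intro iffI allI impI ballI notI)
    fix e assume *: "\<forall>T'. T \<subset> T' \<and> T' \<subseteq> polygon_edges n \<longrightarrow> \<not> crossing_free (2 + 1) T'"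
      "e \<in> polygon_edges n" "e \<notin> T"
    then have "\<not> crossing_free (2 + 1) (insert e T)" using T(1) by blast
    then obtain a b c where "a \<in> insert e T" "b \<in> insert e T" "c \<in> insert e T"
       "edges_cross a b" "edges_cross a c" "edges_cross b c" unfolding F by blast
    then show "\<exists>f\<in>T. \<exists>g\<in>T. edges_cross e f \<and> edges_cross e g \<and> edges_cross f g"
      using T(2) edges_cross_irrefl edges_cross_sym by (metis insert_iff)
  next
    fix T' assume M: "?M" and "T \<subset> T' \<and> T' \<subseteq> polygon_edges n" "crossing_free (2 + 1) T'"
    then have *: "?M" "T \<subset> T'" "T' \<subseteq> polygon_edges n" "crossing_free (2 + 1) T'" by auto
    then obtain e where e: "e \<in> T'" "e \<notin> T" by blast
    then obtain f g where "f \<in> T" "g \<in> T" "edges_cross e f \<and> edges_cross e g \<and> edges_cross f g"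
      using * by blast
    then show False using *(2,4) e(1) unfolding F by blast
  qed
  then show ?thesis unfolding k_triangulation_def F by blast
qed

text \<open>Two crossing edges that both cross \<open>{u, v}\<close> need two distinct vertices on
  each side of it, whereas here one side has at most one vertex. Nothing can block such an edge, so
  maximality puts it into \<open>T\<close>.\<close>

lemma short_edge_mem:
  assumes T: "k_triangulation 2 n T" and "u < v" "v < n" "v \<le> u + 2 \<or> u + n \<le> v + 2"
  shows "{u, v} \<in> T"
proof (rule ccontr)
  assume "{u, v} \<notin> T"
  moreover have "{u, v} \<in> polygon_edges n" using assms by (simp add: polygon_edge_iff)
  ultimately obtain f g where fg: "f \<in> T" "g \<in> T"
    "edges_cross {u, v} f" "edges_cross {u, v} g" "edges_cross f g"
    using T unfolding triangulation_iff by blast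
  have "f \<in> polygon_edges n" "g \<in> polygon_edges n" using fg(1,2) T unfolding triangulation_iff by blast+
  then obtain i j k l where ij: "f = {i, j}" "i < j" "j < n" "g = {k, l}" "k < l" "l < n"
    by (rule polygon_edge_pairE)
  show False
    using fg(3-5) ij(2,3,5,6) assms(2-4) unfolding ij(1,4) by (auto simp: edges_cross_ordered)
qed

text \<open>
  Let \<open>D\<close> be the least \<open>v - u \<ge> 3\<close> over the edges with \<open>v - u \<le> n - 3\<close>. If
  \<open>D > 3\<close>, adding \<open>{u, v - 1}\<close> must create a 3-crossing, one of whose other edges ends at
  \<open>v\<close>; by minimality it is \<open>{v - 2, v}\<close>, and nothing can cross it and \<open>{u, v - 1}\<close>.
\<close>

lemma ear_exists:
  assumes T: "k_triangulation 2 n T" and n: "n \<ge> 6"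
  obtains u where "u + 3 < n" "{u, u + 3} \<in> T"
proof -
  define R where "R D \<longleftrightarrow> (\<exists>u. {u, u + D} \<in> T \<and> u + D < n \<and> 3 \<le> D \<and> D + 3 \<le> n)" for D
  have sub: "T \<subseteq> polygon_edges n"
    and free: "\<And>e f g. \<lbrakk>e \<in> T; f \<in> T; g \<in> T; edges_cross e f; edges_cross e g\<rbrakk> \<Longrightarrow> \<not> edges_cross f g"
    using T unfolding triangulation_iff by blast+
  have max: "\<exists>i j k l. {i, j} \<in> T \<and> i < j \<and> j < n \<and> {k, l} \<in> T \<and> k < l \<and> l < n \<and> i < k \<and>
      edges_cross {u, v} {i, j} \<and> edges_cross {u, v} {k, l} \<and> edges_cross {i, j} {k, l}"
    if uv: "u < v" "v < n" "{u, v} \<notin> T" for u v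
  proof -
    have "{u, v} \<in> polygon_edges n" using uv by (simp add: polygon_edge_iff)
    then obtain f g where fg: "f \<in> T" "g \<in> T"
      "edges_cross {u, v} f" "edges_cross {u, v} g" "edges_cross f g"
      using T uv(3) unfolding triangulation_iff by blast
    have "f \<in> polygon_edges n" "g \<in> polygon_edges n" using fg sub by auto
    then obtain i j k l where ij: "f = {i, j}" "i < j" "j < n" "g = {k, l}" "k < l" "l < n"
      by (rule polygon_edge_pairE)
    show ?thesis
    proof (cases "i < k")
      case True
      then show ?thesis using fg ij by blast
    next
      case False
      moreover have "i \<noteq> k" using fg(5) ij(2,5) unfolding ij(1,4) by (auto simp: edges_cross_ordered)
      ultimately have "k < i" by simp
      then show ?thesis using fg ij edges_cross_sym by blast
    qed
  qed
  have long: "j \<le> i + 2 \<or> i + n \<le> j + 2 \<or> R (j - i)" if "{i, j} \<in> T" "i < j" "j < n" for i j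
    using that unfolding R_def by (auto intro!: exI[of _ i])
  have "\<exists>D. R D"
  proof (rule ccontr)
    assume no: "\<nexists>D. R D"
    then have "\<not> R 3" by blast
    then have "{0, 3} \<notin> T" using n unfolding R_def by (force dest: spec[of _ 0])
    then obtain i j k l where *: "{i, j} \<in> T" "i < j" "j < n" "{k, l} \<in> T" "k < l" "l < n" "i < k"
      "edges_cross {0, 3} {i, j}" "edges_cross {0, 3} {k, l}" "edges_cross {i, j} {k, l}"
      using max[of 0 3] n by auto
    \<comment> \<open>The blocking edges are \<open>{1, j}\<close> and \<open>{2, l}\<close> with
      \<open>3 < j < l < n\<close>, and \<open>{1, j}\<close> is long on both sides.\<close>
    then show False using long[of i j] long[of k l] no by (simp add: edges_cross_ordered; linarith)
  qed
  then have RD: "R (Least R)" by (rule LeastI_ex)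
  define D where "D = Least R"
  have least: "D \<le> D'" if "R D'" for D' using that unfolding D_def by (rule Least_le)
  obtain u where u: "{u, u + D} \<in> T" "u + D < n" "3 \<le> D" "D + 3 \<le> n" using RD unfolding R_def D_def by blast
  have "D = 3"
  proof (rule ccontr)
    assume "D \<noteq> 3"
    then have D: "4 \<le> D" using u by simp
    have "{u, u + D - 1} \<notin> T"
    proof
      assume "{u, u + D - 1} \<in> T"
      then have "R (D - 1)" using u D unfolding R_def by (auto intro!: exI[of _ u])
      then show False using least D by fastforce
    qed
    moreover have short: "u < u + D - 1" "u + D - 1 < n" using u D by auto
    ultimately obtain i j k l where *: "{i, j} \<in> T" "i < j" "j < n" "{k, l} \<in> T" "k < l" "l < n" "i < k"
      "edges_cross {u, u + D - 1} {i, j}" "edges_cross {u, u + D - 1} {k, l}" "edges_cross {i, j} {k, l}"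
      using max[of u "u + D - 1"] short by blast
    then have no: "\<not> (edges_cross {u, u + D} {i, j} \<and> edges_cross {u, u + D} {k, l})"
      using free[OF u(1)] by blast
    have ij: "j \<le> i + 2 \<or> i + n \<le> j + 2 \<or> D + i \<le> j" using long[of i j] least[of "j - i"] * by auto
    have kl: "l \<le> k + 2 \<or> k + n \<le> l + 2 \<or> D + k \<le> l" using long[of k l] least[of "l - k"] * by auto
    have order: "i < k" "k < j" "j < l" using * by (auto simp: edges_cross_ordered)
    \<comment> \<open>Here \<open>v\<close> is the end of the added edge, so the least long edge
      ends at \<open>v + 1\<close>. The name also removes truncated subtraction from the case
      analysis.\<close>
    define v where "v = u + D - 1"
    have v: "u + D = v + 1" "u + 3 \<le> v" "u < v" using D by (auto simp: v_def)
    have *: "u < i \<and> i < v \<and> v < j \<or> i < u \<and> u < j \<and> j < v" "u < k \<and> k < v \<and> v < l \<or> k < u \<and> u < l \<and> l < v"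
      using *(2,5,8,9) v(3) unfolding v_def[symmetric] by (simp_all only: edges_cross_ordered)
    have no: "\<not> ((u < i \<and> i < v + 1 \<and> v + 1 < j \<or> i < u \<and> u < j \<and> j < v + 1) \<and>
       (u < k \<and> k < v + 1 \<and> v + 1 < l \<or> k < u \<and> u < l \<and> l < v + 1))"
      using no \<open>i < j\<close> \<open>k < l\<close> v by (simp add: edges_cross_ordered)
    show False
    proof (cases "u < i")
      case True
      then have "u < k" "k < v" "v < l" "v < j" "i < v" using * order by auto
      \<comment> \<open>The blocking edges cannot both cross \<open>{u, v + 1}\<close>, so one of
        them ends at \<open>v + 1\<close>; as \<open>v < j < l\<close>, it is the one ending at
        \<open>j\<close>.\<close>
      moreover have "j = v + 1" using no True calculation order by auto
      ultimately show False using True order ij v u(2,4) by linarith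
    next
      case False
      then have 1: "i < u" "j < v" "u < j" using * by auto
      show False
      proof (cases "u < k")
        case True
        then have "k < v" "v < l" using * by auto
        moreover have "l = v + 1" using no True calculation 1 order by auto
        ultimately show False using True 1 order kl v u(2,4) by linarith
      next
        case False
        then have "k < u" "l < v" "u < l" using * by auto
        then show False using no 1 by auto
      qed
    qed
  qed
  then show thesis using that u by simp
qed

text \<open>The cyclic shift \<open>v \<mapsto> v - 1\<close>, whose iterates move an ear \<open>{u, u + 3}\<close> to \<open>{n - 1, 2}\<close>.\<close>

definition rot :: "nat \<Rightarrow> nat \<Rightarrow> nat" where
  "rot n v = (if v = 0 then n - 1 else v - 1)"

lemma bij_betw_rot: "bij_betw (rot n) {..<n} {..<n}"
  by (rule bij_betw_byWitness[where f' = "\<lambda>v. if v = n - 1 then 0 else v + 1"])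
    (auto simp: rot_def)

text \<open>The wrap-around concerns only an edge at \<open>0\<close>: its end moves from the first
  to the last place of the natural order, which keeps alternation. Two edges at \<open>0\<close>
  share a vertex before and after the shift.\<close>

lemma edges_cross_rot:
  assumes "i < j" "j < n" "k < l" "l < n"
  shows "edges_cross {rot n i, rot n j} {rot n k, rot n l} \<longleftrightarrow> edges_cross {i, j} {k, l}"
proof -
  obtain m j' l' where eq: "n = Suc m" "j = Suc j'" "l = Suc l'"
    using assms by (metis less_imp_Suc_add)
  show ?thesis
  proof (cases i; cases k)
    fix i' k' assume "i = Suc i'" "k = Suc k'"
    then show ?thesis using assms eq by (simp add: rot_def edges_cross_ordered)
  next
    fix k' assume ik: "i = 0" "k = Suc k'"
    then have "{rot n i, rot n j} = {j', m}" "j' < m" using assms eq by (auto simp: rot_def)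
    then show ?thesis using assms eq ik by (auto simp: rot_def edges_cross_ordered)
  next
    fix i' assume ik: "i = Suc i'" "k = 0"
    then have "{rot n k, rot n l} = {l', m}" "l' < m" using assms eq by (auto simp: rot_def)
    then show ?thesis using assms eq ik by (auto simp: rot_def edges_cross_ordered)
  next
    assume ik: "i = 0" "k = 0"
    then show ?thesis using assms eq by (auto simp: rot_def edges_cross_pair)
  qed
qed

lemma triangulation_rot:
  assumes T: "k_triangulation 2 n T"
  shows "k_triangulation 2 n ((`) (rot n) ` T)"
proof -
  have sub: "T \<subseteq> polygon_edges n" using T unfolding triangulation_iff by blast
  have rot_lt: "rot n v < n" if "v < n" for v using that by (auto simp: rot_def)
  have inj: "inj_on (rot n) {..<n}" using bij_betw_rot by (auto simp: bij_betw_def)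
  have cross: "edges_cross (rot n ` e) (rot n ` f) \<longleftrightarrow> edges_cross e f"
    if ef: "e \<in> polygon_edges n" "f \<in> polygon_edges n" for e f
  proof -
    obtain i j k l where "e = {i, j}" "i < j" "j < n" "f = {k, l}" "k < l" "l < n"
      using ef by (rule polygon_edge_pairE)
    then show ?thesis using edges_cross_rot[of i j n k l] by simp
  qed
  have image: "rot n ` e \<in> polygon_edges n" if e: "e \<in> polygon_edges n" for e
  proof -
    obtain i j where "e = {i, j}" "i < j" "j < n" using e by (rule polygon_edgesE)
    then show ?thesis using rot_lt inj by (auto simp: polygon_edge_iff inj_on_def)
  qed
  have surj: "\<exists>e0\<in>polygon_edges n. e = rot n ` e0" if e: "e \<in> polygon_edges n" for e
  proof -
    obtain i j where ij: "e = {i, j}" "i < j" "j < n" using e by (rule polygon_edgesE)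
    then have "i \<in> rot n ` {..<n}" "j \<in> rot n ` {..<n}" using bij_betw_rot[of n] by (auto simp: bij_betw_def)
    then obtain i' j' where "i = rot n i'" "j = rot n j'" "i' < n" "j' < n" by auto
    then show ?thesis using ij by (intro bexI[of _ "{i', j'}"]) (auto simp: polygon_edge_iff)
  qed
  show ?thesis
    unfolding triangulation_iff
  proof (intro conjI ballI impI)
    show "(`) (rot n) ` T \<subseteq> polygon_edges n" using sub image by blast
  next
    fix e f g assume "e \<in> (`) (rot n) ` T" "f \<in> (`) (rot n) ` T" "g \<in> (`) (rot n) ` T"
    then obtain e' f' g' where *: "e' \<in> T" "f' \<in> T" "g' \<in> T" "e = rot n ` e'" "f = rot n ` f'" "g = rot n ` g'"
      by blast
    then have "\<not> (edges_cross e' f' \<and> edges_cross e' g' \<and> edges_cross f' g')"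
      using T unfolding triangulation_iff by blast
    then show "\<not> (edges_cross e f \<and> edges_cross e g \<and> edges_cross f g)"
      using * sub by (simp add: cross subset_iff)
  next
    fix e assume e: "e \<in> polygon_edges n" "e \<notin> (`) (rot n) ` T"
    then obtain e' where e': "e' \<in> polygon_edges n" "e = rot n ` e'" using surj by blast
    then have "e' \<notin> T" using e by blast
    then obtain f g where "f \<in> T" "g \<in> T" "edges_cross e' f" "edges_cross e' g" "edges_cross f g"
      using T e' unfolding triangulation_iff by blast
    then show "\<exists>f\<in>(`) (rot n) ` T. \<exists>g\<in>(`) (rot n) ` T. edges_cross e f \<and> edges_cross e g \<and> edges_cross f g"
      using sub e' by (intro bexI[of _ "rot n ` f"] bexI[of _ "rot n ` g"]) (auto simp: cross subset_iff)
  qed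
qed

text \<open>A property that can be pulled back along \<open>rot\<close> need only be proved for the
  ear \<open>{2, n - 1}\<close>. The induction runs over the position \<open>u\<close> of some ear,
  which takes \<open>u + 1\<close> shifts to get there.\<close>

lemma triangulation_rotate_ear:
  assumes "k_triangulation 2 n T" "n \<ge> 6"
    and ear: "\<And>T. k_triangulation 2 n T \<Longrightarrow> {2, n - 1} \<in> T \<Longrightarrow> P T"
    and rot: "\<And>T. k_triangulation 2 n T \<Longrightarrow> P ((`) (rot n) ` T) \<Longrightarrow> P T"
  shows "P T"
proof -
  have "P T" if "k_triangulation 2 n T" "u + 3 < n" "{u, u + 3} \<in> T" for u T
    using that
  proof (induction u arbitrary: T)
    case 0
    have "rot n ` {0, 3} = {2, n - 1}" by (auto simp: rot_def)
    then have "{2, n - 1} \<in> (`) (rot n) ` T" using 0(3) by (metis add_0 imageI)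
    then show ?case using rot[OF 0(1)] ear triangulation_rot[OF 0(1)] by blast
  next
    case (Suc u)
    have "rot n ` {Suc u, Suc u + 3} = {u, u + 3}" by (auto simp: rot_def)
    then have "{u, u + 3} \<in> (`) (rot n) ` T" using Suc(4) by (metis imageI)
    then show ?case using rot[OF Suc(2)] Suc.IH[OF triangulation_rot[OF Suc(2)]] Suc(3) by simp
  qed
  then show ?thesis using ear_exists assms(1,2) by blast
qed

subsection \<open>Contracting an ear\<close>

text \<open>
  Truncated subtraction sends both \<open>0\<close> and \<open>1\<close> to \<open>0\<close>, so \<open>v \<mapsto> v - 1\<close>
  glues the vertices \<open>0\<close> and \<open>1\<close>.
\<close>

definition contract :: "nat set set \<Rightarrow> nat set set" where
  "contract T = (`) (\<lambda>v. v - 1) ` (T - {{0, 1}})"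

text \<open>
  The ear \<open>{n, 2}\<close> forces no neighbour of \<open>1\<close> strictly between \<open>2\<close> and
  \<open>n\<close> to lie after such a neighbour of \<open>0\<close>. The last neighbour \<open>x\<close> of \<open>1\<close> is therefore also the first
  neighbour of \<open>0\<close>, and \<open>2\<close>, \<open>x\<close>, \<open>n\<close> are the only common neighbours.
\<close>

lemma contract_ear:
  assumes T: "k_triangulation 2 (n + 1) T" and n: "n \<ge> 5" and ear: "{2, n} \<in> T"
  obtains x where "2 < x" "x < n"
    "{0, 1} \<in> T" "{0, 2} \<in> T" "{1, 2} \<in> T" "{0, n} \<in> T" "{1, n} \<in> T" "{0, x} \<in> T" "{1, x} \<in> T"
    "k_triangulation 2 n (contract T)" "card T = card (contract T) + 4"
proof -
  have sub: "T \<subseteq> polygon_edges (n + 1)"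
    and free: "\<And>e f g. \<lbrakk>e \<in> T; f \<in> T; g \<in> T; edges_cross e f; edges_cross e g\<rbrakk> \<Longrightarrow> \<not> edges_cross f g"
    using T unfolding triangulation_iff by blast+
  have maximal: "\<exists>i j k l. {i, j} \<in> T \<and> i < j \<and> j \<le> n \<and> {k, l} \<in> T \<and> k < l \<and> l \<le> n \<and>
      i < k \<and> k < j \<and> j < l \<and> edges_cross {u, v} {i, j} \<and> edges_cross {u, v} {k, l}"
    if uv: "u < v" "v \<le> n" "{u, v} \<notin> T" for u v
  proof -
    have "{u, v} \<in> polygon_edges (n + 1)" using uv by (simp add: polygon_edge_iff)
    then obtain f g where fg: "f \<in> T" "g \<in> T"
      "edges_cross {u, v} f" "edges_cross {u, v} g" "edges_cross f g"
      using T uv(3) unfolding triangulation_iff by blast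
    have "f \<in> polygon_edges (n + 1)" "g \<in> polygon_edges (n + 1)" using fg(1,2) sub by blast+
    then obtain i j k l where ij: "f = {i, j}" "i < j" "j < n + 1" "g = {k, l}" "k < l" "l < n + 1"
      by (rule polygon_edge_pairE)
    have "i < k \<and> k < j \<and> j < l \<or> k < i \<and> i < l \<and> l < j"
      using fg(5) ij(2,5) unfolding ij(1,4) by (simp add: edges_cross_ordered)
    then show ?thesis
    proof
      assume "i < k \<and> k < j \<and> j < l"
      then show ?thesis
        using fg(1-4) ij(2,3,5,6) unfolding ij(1,4) by (intro exI[of _ i] exI[of _ j] exI[of _ k] exI[of _ l]) simp
    next
      assume "k < i \<and> i < l \<and> l < j"
      then show ?thesis
        using fg(1-4) ij(2,3,5,6) unfolding ij(1,4) by (intro exI[of _ k] exI[of _ l] exI[of _ i] exI[of _ j]) simp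
    qed
  qed
  have short: "{0, 1} \<in> T" "{0, 2} \<in> T" "{1, 2} \<in> T" "{0, n} \<in> T" "{1, n} \<in> T" "{1, 3} \<in> T"
    using short_edge_mem[OF T, of 0 1] short_edge_mem[OF T, of 0 2] short_edge_mem[OF T, of 1 2]
      short_edge_mem[OF T, of 0 n] short_edge_mem[OF T, of 1 n] short_edge_mem[OF T, of 1 3] n by simp_all
  \<comment> \<open>The short edge \<open>{1, 3}\<close> makes this set nonempty, so its maximum
    exists.\<close>
  define N where "N = {z. 2 < z \<and> z < n \<and> {1, z} \<in> T}"
  have N: "finite N" "3 \<in> N"
    using short(6) n by (auto simp: N_def intro: finite_subset[of _ "{..<n}"])
  define x where "x = Max N"
  have "x \<in> N" unfolding x_def using N by (intro Max_in) auto
  then have x: "2 < x" "x < n" "{1, x} \<in> T" by (auto simp: N_def)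
  have x_max: "z \<le> x" if "{1, z} \<in> T" "2 < z" "z < n" for z
    unfolding x_def using N that by (intro Max_ge) (auto simp: N_def)
  have nested: "z \<le> y" if yz: "{0, y} \<in> T" "{1, z} \<in> T" "2 < y" "y < n" "2 < z" "z < n" for y z
  proof (rule ccontr)
    assume "\<not> z \<le> y"
    then have "edges_cross {2, n} {0, y}" "edges_cross {2, n} {1, z}" "edges_cross {0, y} {1, z}"
      using yz by (simp_all add: edges_cross_ordered)
    then show False using free[OF ear yz(1,2)] by blast
  qed
  \<comment> \<open>Two edges blocking \<open>{0, x}\<close> would start strictly between
    \<open>0\<close> and \<open>x\<close>. If the first starts at \<open>1\<close>, it leads to a
    neighbour of \<open>1\<close> beyond \<open>x\<close>; otherwise both also cross
    \<open>{1, x}\<close>, giving a 3-crossing in \<open>T\<close>.\<close>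
  have x0: "{0, x} \<in> T"
  proof (rule ccontr)
    assume "{0, x} \<notin> T"
    then obtain i j k l where *: "{i, j} \<in> T" "i < j" "j \<le> n" "{k, l} \<in> T" "k < l" "l \<le> n"
      "i < k" "k < j" "j < l" "edges_cross {0, x} {i, j}" "edges_cross {0, x} {k, l}"
      using maximal[of 0 x] x by auto
    then have ord: "0 < i" "i < k" "k < x" "x < j" "j < l" using x by (auto simp: edges_cross_ordered)
    show False
    proof (cases "i = 1")
      case True
      then show False using x_max[of j] * ord x by auto
    next
      case False
      then have "edges_cross {1, x} {i, j}" "edges_cross {1, x} {k, l}" "edges_cross {i, j} {k, l}"
        using ord x by (simp_all add: edges_cross_ordered)
      then show False using free[OF x(3) *(1,4)] by blast
    qed
  qed
  have common: "y = 2 \<or> y = x \<or> y = n" if "{0, y} \<in> T" "{1, y} \<in> T" for y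
  proof -
    have "{0, y} \<in> polygon_edges (n + 1)" "{1, y} \<in> polygon_edges (n + 1)" using that sub by blast+
    then have "y \<noteq> 0" "y \<noteq> 1" "y \<le> n" unfolding polygon_edge_iff by auto
    then consider "y = 2" | "y = n" | "2 < y" "y < n" by linarith
    then show ?thesis
      using nested[OF that(1) x(3)] x_max[OF that(2)] x by cases auto
  qed

  define \<phi> where "\<phi> = (`) (\<lambda>v::nat. v - 1)"
  have \<phi>: "\<phi> {i, j} = {i - 1, j - 1}" for i j by (simp add: \<phi>_def)
  have contract: "contract T = \<phi> ` (T - {{0, 1}})" by (simp add: contract_def \<phi>_def)
  have in_contract: "{i - 1, j - 1} \<in> contract T" if "{i, j} \<in> T" "i < j" "1 < j" for i j
  proof -
    have "{i, j} \<noteq> {0, 1}" using that by (auto simp: doubleton_eq_iff)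
    then show ?thesis unfolding contract \<phi>[symmetric] using that(1) by (intro imageI) simp
  qed
  have edgeE: "\<exists>i j. e = {i, j} \<and> i < j \<and> 1 < j \<and> j \<le> n" if e: "e \<in> T" "e \<noteq> {0, 1}" for e
  proof -
    have "e \<in> polygon_edges (n + 1)" using e sub by blast
    then obtain i j where ij: "e = {i, j}" "i < j" "j < n + 1" by (rule polygon_edgesE)
    moreover have "1 < j" using ij e(2) by (cases "i = 0"; cases "j = 1") auto
    ultimately show ?thesis by (intro exI[of _ i] exI[of _ j]) simp
  qed
  \<comment> \<open>Gluing never creates a crossing: a strict inequality between images forces the
    same inequality between the originals. Freeness of the contraction follows at once; only
    maximality needs the structure at the ear.\<close>
  have ordered: "edges_cross {i - 1, j - 1} {k - 1, l - 1} \<Longrightarrow> edges_cross {i, j} {k, l}"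
    if "i < j" "1 < j" "k < l" "1 < l" for i j k l
    using that by (auto simp: edges_cross_ordered)
  have "k_triangulation 2 n (contract T)"
    unfolding triangulation_iff
  proof (intro conjI ballI impI)
    show "contract T \<subseteq> polygon_edges n"
    proof
      fix e' assume "e' \<in> contract T"
      then obtain e where e: "e \<in> T" "e \<noteq> {0, 1}" "e' = \<phi> e" unfolding contract by blast
      then obtain i j where "e = {i, j}" "i < j" "1 < j" "j \<le> n" using edgeE by blast
      then show "e' \<in> polygon_edges n" using e(3) by (auto simp: \<phi> polygon_edge_iff)
    qed
  next
    fix e' f' g' assume "e' \<in> contract T" "f' \<in> contract T" "g' \<in> contract T"
    then obtain e f g where e: "e \<in> T" "e \<noteq> {0, 1}" "e' = \<phi> e" and f: "f \<in> T" "f \<noteq> {0, 1}" "f' = \<phi> f"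
      and g: "g \<in> T" "g \<noteq> {0, 1}" "g' = \<phi> g" unfolding contract by blast
    have "edges_cross (\<phi> a) (\<phi> b) \<Longrightarrow> edges_cross a b"
      if ab: "a \<in> T" "a \<noteq> {0, 1}" "b \<in> T" "b \<noteq> {0, 1}" for a b
    proof -
      obtain i j k l where "a = {i, j}" "i < j" "1 < j" "b = {k, l}" "k < l" "1 < l"
        using edgeE[OF ab(1,2)] edgeE[OF ab(3,4)] by blast
      then show "edges_cross (\<phi> a) (\<phi> b) \<Longrightarrow> edges_cross a b" using ordered by (simp add: \<phi>)
    qed
    then show "\<not> (edges_cross e' f' \<and> edges_cross e' g' \<and> edges_cross f' g')"
      using free[OF e(1) f(1) g(1)] e f g by blast
  next
    fix e' assume e': "e' \<in> polygon_edges n" "e' \<notin> contract T"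
    obtain p q where pq: "e' = {p, q}" "p < q" "q < n" using e'(1) by (rule polygon_edgesE)
    have conclude: "\<exists>f\<in>contract T. \<exists>g\<in>contract T. edges_cross e' f \<and> edges_cross e' g \<and> edges_cross f g"
      if "{i, j} \<in> T" "{k, l} \<in> T" "i - 1 < k - 1" "k < j" "j < l"
        "p < i - 1 \<and> i - 1 < q \<and> q < j - 1 \<or> i - 1 < p \<and> p < j - 1 \<and> j - 1 < q"
        "p < k - 1 \<and> k - 1 < q \<and> q < l - 1 \<or> k - 1 < p \<and> p < l - 1 \<and> l - 1 < q" for i j k l
    proof -
      have "i < j" "1 < j" "k < l" "1 < l" using that(3-5) by linarith+
      then have mem: "{i - 1, j - 1} \<in> contract T" "{k - 1, l - 1} \<in> contract T"
        using that(1,2) in_contract by blast+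
      have ord: "i - 1 < j - 1" "k - 1 < l - 1" "k - 1 < j - 1 \<and> j - 1 < l - 1"
        using that(3-5) by linarith+
      have "edges_cross {p, q} {i - 1, j - 1}" "edges_cross {p, q} {k - 1, l - 1}"
        "edges_cross {i - 1, j - 1} {k - 1, l - 1}"
        unfolding edges_cross_ordered[OF pq(2) ord(1)] edges_cross_ordered[OF pq(2) ord(2)]
          edges_cross_ordered[OF ord(1,2)] using that(3,6,7) ord(3) by blast+
      then show ?thesis unfolding pq(1) using mem by blast
    qed
    show "\<exists>f\<in>contract T. \<exists>g\<in>contract T. edges_cross e' f \<and> edges_cross e' g \<and> edges_cross f g"
    \<comment> \<open>Away from the glued vertex the missing edge has the single lift
      \<open>{p + 1, q + 1}\<close>. Its blocking edges remain crossing after the contraction unless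
      they start at \<open>0\<close> and \<open>1\<close>; then \<open>nested\<close> contradicts
      \<open>j < l\<close>.\<close>
    proof (cases "p = 0")
      case False
      have "{p + 1, q + 1} \<notin> T" using in_contract[of "p + 1" "q + 1"] e'(2) pq by auto
      then obtain i j k l where *: "{i, j} \<in> T" "i < j" "j \<le> n" "{k, l} \<in> T" "k < l" "l \<le> n"
        "i < k" "k < j" "j < l" "edges_cross {p + 1, q + 1} {i, j}" "edges_cross {p + 1, q + 1} {k, l}"
        using maximal[of "p + 1" "q + 1"] pq by auto
      then have c: "p + 1 < i \<and> i < q + 1 \<and> q + 1 < j \<or> i < p + 1 \<and> p + 1 < j \<and> j < q + 1"
        "p + 1 < k \<and> k < q + 1 \<and> q + 1 < l \<or> k < p + 1 \<and> p + 1 < l \<and> l < q + 1"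
        using pq(2) by (simp_all add: edges_cross_ordered)
      have "\<not> (i = 0 \<and> k = 1)"
      proof
        assume "i = 0 \<and> k = 1"
        then have "2 < j" "j < n" "2 < l" "l < n" "{0, j} \<in> T" "{1, l} \<in> T"
          using * c False pq by auto
        then show False using nested[of j l] *(9) by simp
      qed
      then have "i - 1 < k - 1" using *(7) by linarith
      moreover have "p < i - 1 \<and> i - 1 < q \<and> q < j - 1 \<or> i - 1 < p \<and> p < j - 1 \<and> j - 1 < q"
        "p < k - 1 \<and> k - 1 < q \<and> q < l - 1 \<or> k - 1 < p \<and> p < l - 1 \<and> l - 1 < q"
        using c False by linarith+
      ultimately show ?thesis using conclude *(1,4,8,9) by blast
    next
      case True
      have q: "q \<noteq> 1" "q + 1 \<noteq> n" "q + 1 \<noteq> x" "0 < q"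
        using in_contract[OF short(3)] in_contract[OF short(5)] in_contract[OF x(3)] x n e'(2) pq True by auto
      show ?thesis
      \<comment> \<open>Both lifts \<open>{0, q + 1}\<close> and \<open>{1, q + 1}\<close> are
        missing. Beyond \<open>x\<close> the lift at \<open>0\<close> is used, since a blocking edge
        at \<open>1\<close> would pass \<open>x\<close>; before \<open>x\<close> the lift at
        \<open>1\<close> is used, since a blocking edge at \<open>0\<close> would end before
        \<open>x\<close>, against \<open>nested\<close>. So no blocking edge meets the glued
        vertex.\<close>
      proof (cases "x < q + 1")
        case True
        have "{0, q + 1} \<notin> T" using in_contract[of 0 "q + 1"] e'(2) pq \<open>p = 0\<close> by auto
        then obtain i j k l where *: "{i, j} \<in> T" "i < j" "j \<le> n" "{k, l} \<in> T" "k < l" "l \<le> n"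
          "i < k" "k < j" "j < l" "edges_cross {0, q + 1} {i, j}" "edges_cross {0, q + 1} {k, l}"
          using maximal[of "0" "q + 1"] pq by auto
        then have c: "0 < i" "k < q + 1" "q + 1 < j" by (auto simp: edges_cross_ordered)
        have "i \<noteq> 1"
        proof
          assume "i = 1"
          moreover have "2 < j" "j < n" using c(3) x(1) True *(6,9) by linarith+
          ultimately have "j \<le> x" using x_max *(1) by blast
          then show False using c(3) True by linarith
        qed
        then have "i - 1 < k - 1" "p < i - 1 \<and> i - 1 < q \<and> q < j - 1" "p < k - 1 \<and> k - 1 < q \<and> q < l - 1"
          using c *(7-9) \<open>p = 0\<close> by linarith+
        then show ?thesis using conclude *(1,4,8,9) by blast
      next
        case False
        have "{1, q + 1} \<notin> T" using in_contract[of 1 "q + 1"] e'(2) pq \<open>p = 0\<close> by auto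
        then obtain i j k l where *: "{i, j} \<in> T" "i < j" "j \<le> n" "{k, l} \<in> T" "k < l" "l \<le> n"
          "i < k" "k < j" "j < l" "edges_cross {1, q + 1} {i, j}" "edges_cross {1, q + 1} {k, l}"
          using maximal[of 1 "q + 1"] pq q by auto
        then have c: "1 < i \<and> i < q + 1 \<and> q + 1 < j \<or> i < 1 \<and> 1 < j \<and> j < q + 1"
          "1 < k \<and> k < q + 1 \<and> q + 1 < l \<or> k < 1 \<and> 1 < l \<and> l < q + 1"
          using q by (simp_all add: edges_cross_ordered)
        have "i \<noteq> 0"
        proof
          assume "i = 0"
          then have "1 < j" "j < q + 1" "1 < k" using c *(7) by auto
          then have "2 < j" "j < n" using *(8) pq by auto
          then show False using nested[of j x] \<open>i = 0\<close> *(1) x False \<open>j < q + 1\<close> by auto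
        qed
        then have "i - 1 < k - 1" "p < i - 1 \<and> i - 1 < q \<and> q < j - 1" "p < k - 1 \<and> k - 1 < q \<and> q < l - 1"
          using c *(7) \<open>p = 0\<close> by linarith+
        then show ?thesis using conclude *(1,4,8,9) by blast
      qed
    qed
  qed
  moreover have "card T = card (contract T) + 4"
  proof -
    \<comment> \<open>The four edges lost: the contracted edge, and one from each of the three pairs
      identified by the gluing.\<close>
    let ?D = "{{0, 1}, {0, 2}, {0, x}, {0, n}}"
    have fin: "finite T" using sub finite_polygon_edges finite_subset by blast
    have D: "?D \<subseteq> T" "card ?D = 4" using short x0 x by (auto simp: doubleton_eq_iff card_insert_if)
    have inj: "inj_on \<phi> (T - ?D)"
    proof (rule inj_onI)
      fix e f assume ef: "e \<in> T - ?D" "f \<in> T - ?D" "\<phi> e = \<phi> f"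
      have e: "e \<in> T" "e \<noteq> {0, 1}" and f: "f \<in> T" "f \<noteq> {0, 1}" using ef(1,2) by blast+
      obtain i j k l where ij: "e = {i, j}" "i < j" "1 < j" "f = {k, l}" "k < l" "1 < l"
        using edgeE[OF e] edgeE[OF f] by blast
      have "i - 1 = k - 1 \<and> j - 1 = l - 1 \<or> i - 1 = l - 1 \<and> j - 1 = k - 1"
        using ef(3) unfolding ij(1,4) \<phi> doubleton_eq_iff .
      then have "i - 1 = k - 1" "j = l" using ij(2,3,5,6) by linarith+
      moreover have "i = k"
      proof (rule ccontr)
        assume "i \<noteq> k"
        then have "i = 0 \<and> k = 1 \<or> i = 1 \<and> k = 0" using calculation by auto
        then have "{0, j} \<in> T - ?D \<and> {1, j} \<in> T"
          using ef(1,2) calculation(2) unfolding ij(1,4) by (elim disjE conjE) simp_all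
        then show False using common[of j] by blast
      qed
      ultimately show "e = f" using ij by simp
    qed
    have "contract T = \<phi> ` (T - ?D)"
    proof
      show "\<phi> ` (T - ?D) \<subseteq> contract T" unfolding contract by blast
      show "contract T \<subseteq> \<phi> ` (T - ?D)"
      proof
        fix e' assume "e' \<in> contract T"
        then obtain e where e: "e \<in> T" "e \<noteq> {0, 1}" "e' = \<phi> e" unfolding contract by blast
        show "e' \<in> \<phi> ` (T - ?D)"
        proof (cases "e \<in> ?D")
          case True
          then obtain y where y: "e = {0, y}" "y = 2 \<or> y = x \<or> y = n" using e by blast
          then have "{1, y} \<in> T - ?D" "\<phi> {1, y} = \<phi> e"
            using short x n by (auto simp: \<phi> doubleton_eq_iff)
          then show ?thesis using e(3) by (metis imageI)
        qed (use e in blast)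
      qed
    qed
    then have "card (contract T) = card (T - ?D)" using card_image[OF inj] by simp
    moreover have "card T = card (T - ?D) + card ?D"
      using card_Diff_subset[of ?D T] card_mono[OF fin D(1)] D fin by auto
    ultimately show ?thesis using D(2) by simp
  qed
  ultimately show thesis using that[of x] x short x0 by blast
qed

subsection \<open>The rigidity matrix\<close>

text \<open>Velocity fields of one-parameter families of isometries:
  \<open>A x \<bullet> x = 0\<close> says that \<open>A\<close> is skew-symmetric, and
  \<open>b\<close> is the translational part.\<close>

definition trivial_flex :: "nat \<Rightarrow> (nat \<Rightarrow> real ^ 'd) \<Rightarrow> (nat \<Rightarrow> real ^ 'd) \<Rightarrow> bool" where
  "trivial_flex n p d \<longleftrightarrow>
     (\<exists>A b. linear A \<and> (\<forall>x. A x \<bullet> x = 0) \<and> (\<forall>v<n. d v = A (p v) + b))"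

definition edge_flex :: "nat set set \<Rightarrow> (nat \<Rightarrow> real ^ 'd) \<Rightarrow> (nat \<Rightarrow> real ^ 'd) \<Rightarrow> bool" where
  "edge_flex E p d \<longleftrightarrow> (\<forall>u v. {u, v} \<in> E \<longrightarrow> (p u - p v) \<bullet> (d u - d v) = 0)"

definition inf_rigid :: "nat \<Rightarrow> nat set set \<Rightarrow> (nat \<Rightarrow> real ^ 'd) \<Rightarrow> bool" where
  "inf_rigid n E p \<longleftrightarrow> (\<forall>d. edge_flex E p d \<longrightarrow> trivial_flex n p d)"

text \<open>
  The rows \<open>Inl e\<close> express preservation of the length of \<open>e\<close> for an edge of direction
  \<open>D e\<close>; the direction is kept independent of \<open>p\<close> so that a collapsed edge still has a
  useful row. The rows \<open>Inr (i, j)\<close> express orthogonality to the infinitesimal translations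
  (\<open>i = j\<close>) and rotations (\<open>i < j\<close>) of \<open>p\<close>; they make the system square when
  the number of edges is the expected one.
\<close>

fun rigidity_row ::
  "(nat set \<Rightarrow> real ^ 'd) \<Rightarrow> (nat \<Rightarrow> real ^ 'd) \<Rightarrow> nat set + 'd \<times> 'd \<Rightarrow> nat \<Rightarrow> real ^ 'd" where
  "rigidity_row D p (Inl e) v = (if v = Min e then D e else if v = Max e then - D e else 0)"
| "rigidity_row D p (Inr (i, j)) v =
     (if i = j then axis i 1 else p v $ i *\<^sub>R axis j 1 - p v $ j *\<^sub>R axis i 1)"

definition rigidity_rows :: "nat set set \<Rightarrow> (nat set + 'd::{finite,linorder} \<times> 'd) set" where
  "rigidity_rows E = Inl ` E \<union> Inr ` {(i, j). i \<le> j}"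

definition rigidity_cols :: "nat \<Rightarrow> (nat \<times> 'd::finite) set" where
  "rigidity_cols n = {0..<n} \<times> UNIV"

definition rigidity_matrix ::
  "(nat set \<Rightarrow> real ^ 'd) \<Rightarrow> (nat \<Rightarrow> real ^ 'd) \<Rightarrow> nat set + 'd \<times> 'd \<Rightarrow> nat \<times> 'd \<Rightarrow> real" where
  "rigidity_matrix D p r c = rigidity_row D p r (fst c) $ snd c"

definition edge_vector :: "(nat \<Rightarrow> real ^ 'd) \<Rightarrow> nat set \<Rightarrow> real ^ 'd" where
  "edge_vector p e = p (Min e) - p (Max e)"

definition regular :: "nat \<Rightarrow> nat set set \<Rightarrow> (nat set \<Rightarrow> real ^ 'd::{finite,linorder}) \<Rightarrow> (nat \<Rightarrow> real ^ 'd::{finite,linorder}) \<Rightarrow> bool" where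
  "regular n E D p \<longleftrightarrow> nonsing (rigidity_rows E) (rigidity_cols n) (rigidity_matrix D p)"

text \<open>The pairs \<open>i \<le> j\<close> stand for the translations and the rotations of
  coordinate planes. The count is doubled to avoid division.\<close>

lemma card_rigidity_rows:
  assumes "finite E"
  shows "2 * card (rigidity_rows E :: (nat set + 'd \<times> 'd::{finite,linorder}) set) =
    2 * card E + CARD('d) * (CARD('d) + 1)"
proof -
  let ?A = "{(i, j). (i::'d) \<le> j}" and ?B = "{(i, j). (j::'d) \<le> i}"
  have "card ?A = card ?B"
    by (rule bij_betw_same_card[of prod.swap]) (auto simp: bij_betw_def inj_on_def image_iff)
  moreover have "card ?A + card ?B = card (?A \<union> ?B) + card (?A \<inter> ?B)"
    by (rule card_Un_Int) auto
  moreover have "?A \<union> ?B = UNIV" by auto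
  moreover have "card (?A \<inter> ?B) = CARD('d)"
    by (rule bij_betw_same_card[of fst]) (rule bij_betw_byWitness[where f' = "\<lambda>i. (i, i)"], auto)
  ultimately have "2 * card ?A = CARD('d) * CARD('d) + CARD('d)" by (simp add: card_prod)
  moreover have "card (rigidity_rows E :: (nat set + 'd \<times> 'd) set) = card E + card ?A"
    unfolding rigidity_rows_def using assms
    by (subst card_Un_disjoint) (auto simp: card_image)
  ultimately show ?thesis by simp
qed

lemma finite_rigidity_rows: "finite E \<Longrightarrow> finite (rigidity_rows E)"
  unfolding rigidity_rows_def by simp

lemma finite_rigidity_cols: "finite (rigidity_cols n)"
  unfolding rigidity_cols_def by simp

lemma card_rigidity_cols: "card (rigidity_cols n :: (nat \<times> 'd::finite) set) = n * CARD('d)"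
  unfolding rigidity_cols_def by (simp add: card_cartesian_product)

lemma rigidity_matrix_sum:
  "(\<Sum>c\<in>rigidity_cols n. rigidity_matrix D p r c * x c) =
     (\<Sum>v<n. rigidity_row D p r v \<bullet> (\<chi> k. x (v, k)))"
  unfolding rigidity_cols_def rigidity_matrix_def inner_vec_def sum.cartesian_product atLeast0LessThan
  by (intro sum.cong) auto

lemma regular_iff:
  "regular n E D p \<longleftrightarrow>
     (\<forall>d. (\<forall>r\<in>rigidity_rows E. (\<Sum>v<n. rigidity_row D p r v \<bullet> d v) = 0) \<longrightarrow> (\<forall>v<n. d v = 0))"
  unfolding regular_def nonsing_def rigidity_matrix_sum
proof (intro iffI allI impI)
  fix d v
  assume *: "\<forall>x. (\<forall>r\<in>rigidity_rows E. (\<Sum>v<n. rigidity_row D p r v \<bullet> (\<chi> k. x (v, k))) = 0) \<longrightarrow>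
     (\<forall>c\<in>rigidity_cols n. x c = 0)"
    "\<forall>r\<in>rigidity_rows E. (\<Sum>v<n. rigidity_row D p r v \<bullet> d v) = 0" "v < n"
  have "\<forall>c\<in>rigidity_cols n. (\<lambda>(v, k). d v $ k) c = 0"
    using *(1)[THEN spec, of "\<lambda>(v, k). d v $ k"] *(2) by simp
  then have "d v $ k = 0" for k using *(3) by (auto simp: rigidity_cols_def dest: bspec[of _ _ "(v, k)"])
  then show "d v = 0" by (simp add: Finite_Cartesian_Product.vec_eq_iff)
next
  fix x
  assume *: "\<forall>d. (\<forall>r\<in>rigidity_rows E. (\<Sum>v<n. rigidity_row D p r v \<bullet> d v) = 0) \<longrightarrow> (\<forall>v<n. d v = 0)"
    "\<forall>r\<in>rigidity_rows E. (\<Sum>v<n. rigidity_row D p r v \<bullet> (\<chi> k. x (v, k))) = 0"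
  have "\<forall>v<n. (\<chi> k. x (v, k)) = 0" 
    using *(1)[THEN spec, of "\<lambda>v. \<chi> k. x (v, k)"] *(2) by simp
  then show "\<forall>c\<in>rigidity_cols n. x c = 0"
    by (auto simp: Finite_Cartesian_Product.vec_eq_iff rigidity_cols_def)
qed

lemma edge_row_sum:
  assumes "u < v" "v < n"
  shows "(\<Sum>w<n. rigidity_row D p (Inl {u, v}) w \<bullet> d w) = D {u, v} \<bullet> (d u - d v)"
proof -
  have "(\<Sum>w<n. rigidity_row D p (Inl {u, v}) w \<bullet> d w) =
    (\<Sum>w<n. (if w = u then D {u, v} \<bullet> d u else 0) - (if w = v then D {u, v} \<bullet> d v else 0))"
    using assms by (intro sum.cong) auto
  also have "\<dots> = D {u, v} \<bullet> (d u - d v)"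
    using assms by (simp add: sum_subtractf inner_diff_right)
  finally show ?thesis .
qed

lemma edge_vector_pair: "u < v \<Longrightarrow> edge_vector p {u, v} = p u - p v"
  by (simp add: edge_vector_def)

lemma inner_diff_swap: "(b - a) \<bullet> (d - c) = (a - b) \<bullet> (c - d)" for a b c d :: "'a::real_inner"
  by (simp add: inner_diff_left inner_diff_right)

lemma edge_flex_iff:
  assumes "E \<subseteq> polygon_edges n"
  shows "edge_flex E p d \<longleftrightarrow>
    (\<forall>e\<in>E. (\<Sum>w<n. rigidity_row (edge_vector p) p (Inl e) w \<bullet> d w) = 0)"
proof
  assume flex: "edge_flex E p d"
  show "\<forall>e\<in>E. (\<Sum>w<n. rigidity_row (edge_vector p) p (Inl e) w \<bullet> d w) = 0"
  proof
    fix e assume e: "e \<in> E"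
    then have "e \<in> polygon_edges n" using assms by blast
    then obtain u v where uv: "e = {u, v}" "u < v" "v < n" by (rule polygon_edgesE)
    then show "(\<Sum>w<n. rigidity_row (edge_vector p) p (Inl e) w \<bullet> d w) = 0"
      unfolding uv(1) edge_row_sum[OF uv(2,3)] edge_vector_pair[OF uv(2)]
      using flex e uv(1) unfolding edge_flex_def by blast
  qed
next
  assume *: "\<forall>e\<in>E. (\<Sum>w<n. rigidity_row (edge_vector p) p (Inl e) w \<bullet> d w) = 0"
  have lt: "(p u - p v) \<bullet> (d u - d v) = 0" if "{u, v} \<in> E" "u < v" for u v
  proof -
    have "v < n" using that(1) assms by (auto simp: polygon_edge_iff dest: subsetD)
    from edge_row_sum[OF that(2) this] show ?thesis
      using * that edge_vector_pair[OF that(2)] by metis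
  qed
  show "edge_flex E p d"
    unfolding edge_flex_def
  proof (intro allI impI)
    fix u v assume uv: "{u, v} \<in> E"
    have "(p u - p v) \<bullet> (d u - d v) = (p v - p u) \<bullet> (d v - d u)"
      by (rule inner_diff_swap)
    then show "(p u - p v) \<bullet> (d u - d v) = 0"
      using lt[of u v] lt[of v u] uv by (cases u v rule: linorder_cases) (auto simp: insert_commute)
  qed
qed

section \<open>Trivial flexes and the kernel of the rigidity matrix\<close>

lemma skew_polarization:
  assumes "linear A" "\<And>x. A x \<bullet> x = 0"
  shows "A x \<bullet> y = - (A y \<bullet> x)"
proof -
  have "A (x + y) \<bullet> (x + y) = A x \<bullet> x + A x \<bullet> y + A y \<bullet> x + A y \<bullet> y"
    by (simp add: linear_add[OF assms(1)] inner_add_left inner_add_right)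
  then show ?thesis using assms(2) by simp
qed

lemma trivial_flex_edge:
  assumes "trivial_flex n p d" "u < n" "v < n"
  shows "(p u - p v) \<bullet> (d u - d v) = 0"
proof -
  obtain A b where A: "linear A" "\<forall>x. A x \<bullet> x = 0" "\<forall>v<n. d v = A (p v) + b"
    using assms(1) unfolding trivial_flex_def by blast
  have "d u - d v = A (p u - p v)" using A(3) assms(2,3) by (simp add: linear_diff[OF A(1)])
  then show ?thesis using A(2) by (simp add: inner_commute)
qed

text \<open>A trivial flex orthogonal to all translations and rotations is orthogonal to itself. In
  coordinates, orthogonality to the rotations makes the moment matrix \<open>S\<close> symmetric,
  and its pairing with the skew matrix \<open>a\<close> vanishes. The position may be degenerate, as
  it is when two vertices are glued.\<close>

lemma trivial_orthogonal_zero: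
  fixes p d :: "nat \<Rightarrow> real ^ 'd::{finite,linorder}"
  assumes triv: "trivial_flex n p d"
    and orth: "\<And>i j. i \<le> j \<Longrightarrow> (\<Sum>v<n. rigidity_row D p (Inr (i, j)) v \<bullet> d v) = 0"
  shows "\<forall>v<n. d v = 0"
proof -
  obtain A b where A: "linear A" "\<And>x. A x \<bullet> x = 0" "\<And>v. v < n \<Longrightarrow> d v = A (p v) + b"
    using triv unfolding trivial_flex_def by blast
  define S where "S i j = (\<Sum>v<n. p v $ i * d v $ j)" for i j
  define a where "a i j = A (axis i 1) $ j" for i j
  have transl: "(\<Sum>v<n. d v $ i) = 0" for i
    using orth[of i i] by (simp add: inner_axis')
  have "S i j - S j i = 0" if "i < j" for i j
    using orth[of i j] that[unfolded less_le] by (simp add: S_def inner_diff_left inner_axis' sum_subtractf)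
  then have S: "S i j = S j i" for i j by (cases i j rule: linorder_cases) force+
  have skew: "a i j = - a j i" for i j
    using skew_polarization[OF A(1,2), of "axis i 1" "axis j 1"] by (simp add: a_def inner_axis)
  have Ax: "A x \<bullet> y = (\<Sum>i\<in>UNIV. \<Sum>j\<in>UNIV. a i j * (x $ i * y $ j))" for x y
  proof -
    have "(\<Sum>i\<in>UNIV. x $ i *\<^sub>R axis i 1) = x"
      using basis_expansion[of x] unfolding scalar_mult_eq_scaleR .
    then have "A x = A (\<Sum>i\<in>UNIV. x $ i *\<^sub>R axis i 1)" by simp
    also have "\<dots> = (\<Sum>i\<in>UNIV. x $ i *\<^sub>R A (axis i 1))"
      by (simp add: linear_sum[OF A(1)] linear_scale[OF A(1)])
    finally have "A x \<bullet> y = (\<Sum>i\<in>UNIV. x $ i * (A (axis i 1) \<bullet> y))" by (simp add: inner_sum_left)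
    also have "\<dots> = (\<Sum>i\<in>UNIV. \<Sum>j\<in>UNIV. a i j * (x $ i * y $ j))"
      unfolding inner_vec_def sum_distrib_left a_def by (simp add: mult_ac)
    finally show ?thesis .
  qed
  have "(\<Sum>v<n. A (p v) \<bullet> d v) = (\<Sum>i\<in>UNIV. \<Sum>j\<in>UNIV. a i j * S i j)"
    unfolding Ax S_def sum_distrib_left
    by (subst sum.swap, intro sum.cong refl, subst sum.swap, rule refl)
  moreover have "(\<Sum>i\<in>UNIV. \<Sum>j\<in>UNIV. a i j * S i j) = (\<Sum>i\<in>UNIV. \<Sum>j\<in>UNIV. a j i * S j i)"
    by (rule sum.swap)
  moreover have "(\<Sum>i\<in>UNIV. \<Sum>j\<in>UNIV. a j i * S j i) = - (\<Sum>i\<in>UNIV. \<Sum>j\<in>UNIV. a i j * S i j)"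
  proof -
    have "a j i * S j i = - (a i j * S i j)" for i j
      by (subst skew, subst S) simp
    then have "(\<Sum>i\<in>UNIV. \<Sum>j\<in>UNIV. a j i * S j i) = (\<Sum>i\<in>UNIV. \<Sum>j\<in>UNIV. - (a i j * S i j))"
      by (rule sum.cong[OF refl, OF sum.cong[OF refl]])
    then show ?thesis by (simp add: sum_negf)
  qed
  ultimately have "(\<Sum>v<n. A (p v) \<bullet> d v) = 0" by linarith
  moreover have "(\<Sum>v<n. b \<bullet> d v) = 0"
  proof -
    have "(\<Sum>v<n. d v) = 0" using transl by (simp add: Finite_Cartesian_Product.vec_eq_iff)
    then show ?thesis by (simp add: inner_sum_right[symmetric])
  qed
  moreover have "(\<Sum>v<n. d v \<bullet> d v) = (\<Sum>v<n. A (p v) \<bullet> d v) + (\<Sum>v<n. b \<bullet> d v)"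
    unfolding sum.distrib[symmetric]
  proof (rule sum.cong[OF refl])
    fix v assume "v \<in> {..<n}"
    then have "d v = A (p v) + b" using A(3) by simp
    then show "d v \<bullet> d v = A (p v) \<bullet> d v + b \<bullet> d v" by (metis inner_add_left)
  qed
  ultimately have "(\<Sum>v<n. d v \<bullet> d v) = 0" by simp
  then show ?thesis by (simp add: sum_nonneg_eq_0_iff)
qed

text \<open>Orthogonal projection onto the span of a finite family, adding one vector at a time
  after making it orthogonal to the earlier ones. The family may be linearly dependent.\<close>

lemma projection_exists:
  fixes t :: "'k \<Rightarrow> nat \<Rightarrow> 'a::real_inner"
  assumes "finite K"
  shows "\<exists>c. \<forall>k\<in>K. (\<Sum>v<n. (d v - (\<Sum>l\<in>K. c l *\<^sub>R t l v)) \<bullet> t k v) = 0"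
  using assms
proof (induction K arbitrary: d rule: finite_induct)
  case (insert m K)
  define ip where "ip f g = (\<Sum>v<n. f v \<bullet> g v)" for f g :: "nat \<Rightarrow> 'a"
  obtain c where c: "\<forall>k\<in>K. ip (\<lambda>v. d v - (\<Sum>l\<in>K. c l *\<^sub>R t l v)) (t k) = 0"
    using insert.IH[of d] unfolding ip_def by blast
  obtain a where a: "\<forall>k\<in>K. ip (\<lambda>v. t m v - (\<Sum>l\<in>K. a l *\<^sub>R t l v)) (t k) = 0"
    using insert.IH[of "t m"] unfolding ip_def by blast
  define r where "r v = d v - (\<Sum>l\<in>K. c l *\<^sub>R t l v)" for v
  define s where "s v = t m v - (\<Sum>l\<in>K. a l *\<^sub>R t l v)" for v
  have ip_diff: "ip (\<lambda>v. f v - x *\<^sub>R g v) h = ip f h - x * ip g h" for f g h x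
    unfolding ip_def by (simp add: inner_diff_left sum_subtractf sum_distrib_left)
  \<comment> \<open>If the residual \<open>s\<close> of the new vector is zero, the quotient takes
    its default value \<open>0\<close> and nothing is subtracted.\<close>
  define x where "x = ip r s / ip s s"
  have perp: "ip (\<lambda>v. r v - x *\<^sub>R s v) (t k) = 0" if "k \<in> K" for k
    using a c that unfolding ip_diff r_def[symmetric] s_def[symmetric] by simp
  have "ip f (t m) = ip f s + (\<Sum>l\<in>K. a l * ip f (t l))" for f
  proof -
    have "ip f (t m) = ip f (\<lambda>v. s v + (\<Sum>l\<in>K. a l *\<^sub>R t l v))" by (simp add: s_def)
    also have "\<dots> = ip f s + (\<Sum>v<n. \<Sum>l\<in>K. a l * (f v \<bullet> t l v))"
      unfolding ip_def by (simp add: inner_add_right sum.distrib inner_sum_right)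
    also have "(\<Sum>v<n. \<Sum>l\<in>K. a l * (f v \<bullet> t l v)) = (\<Sum>l\<in>K. a l * ip f (t l))"
      unfolding ip_def sum_distrib_left by (rule sum.swap)
    finally show ?thesis .
  qed
  from this[of "\<lambda>v. r v - x *\<^sub>R s v"]
  have "ip (\<lambda>v. r v - x *\<^sub>R s v) (t m) = ip r s - x * ip s s"
    using perp by (simp add: ip_diff)
  also have "\<dots> = 0"
  proof (cases "ip s s = 0")
    case True
    then have "\<forall>v<n. s v = 0" unfolding ip_def by (simp add: sum_nonneg_eq_0_iff)
    then show ?thesis unfolding ip_def by simp
  qed (simp add: x_def)
  finally have perp_m: "ip (\<lambda>v. r v - x *\<^sub>R s v) (t m) = 0" .
  define c' where "c' l = (if l = m then x else c l - x * a l)" for l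
  have "r v - x *\<^sub>R s v = d v - (\<Sum>l\<in>insert m K. c' l *\<^sub>R t l v)" for v
  proof -
    have "(\<Sum>l\<in>K. c' l *\<^sub>R t l v) = (\<Sum>l\<in>K. c l *\<^sub>R t l v) - x *\<^sub>R (\<Sum>l\<in>K. a l *\<^sub>R t l v)"
      unfolding scaleR_right.sum sum_subtractf[symmetric] using insert.hyps
      by (intro sum.cong) (auto simp: c'_def scaleR_diff_left)
    then show ?thesis
      using insert.hyps by (simp add: r_def s_def c'_def scaleR_diff_right)
  qed
  then have "\<forall>k\<in>insert m K. (\<Sum>v<n. (d v - (\<Sum>l\<in>insert m K. c' l *\<^sub>R t l v)) \<bullet> t k v) = 0"
    using perp perp_m unfolding ip_def by simp
  then show ?case by blast
qed simp

text \<open>Read as velocities instead of linear forms, the normalising rows are the translations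
  and rotations themselves, so projecting onto them removes only a trivial flex.\<close>

lemma trivial_rows_trivial_flex:
  fixes p :: "nat \<Rightarrow> real ^ 'd" and D :: "nat set \<Rightarrow> real ^ 'd"
  shows "trivial_flex n p (\<lambda>v. \<Sum>l\<in>K. c l *\<^sub>R rigidity_row D p (Inr l) v)"
proof -
  define A :: "real ^ 'd \<Rightarrow> real ^ 'd" where
    "A = (\<lambda>x. \<Sum>(i, j)\<in>K. c (i, j) *\<^sub>R (if i = j then 0 else x $ i *\<^sub>R axis j 1 - x $ j *\<^sub>R axis i 1))"
  define b :: "real ^ 'd" where "b = (\<Sum>(i, j)\<in>K. c (i, j) *\<^sub>R (if i = j then axis i 1 else 0))"
  have "linear A"
    unfolding A_def by (rule linearI)
      (auto simp: sum.distrib[symmetric] scaleR_right.sum algebra_simps intro!: sum.cong)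
  moreover have "A x \<bullet> x = 0" for x
    unfolding A_def inner_sum_left
    by (intro sum.neutral) (auto simp: inner_diff_left inner_axis' )
  moreover have "(\<Sum>l\<in>K. c l *\<^sub>R rigidity_row D p (Inr l) v) = A (p v) + b" for v
    unfolding A_def b_def sum.distrib[symmetric] by (intro sum.cong) auto
  ultimately show ?thesis unfolding trivial_flex_def by blast
qed

text \<open>A kernel vector is a flex satisfying the normalisation, so rigidity makes it trivial and
  hence zero. Conversely, a flex minus its projection onto the trivial flexes lies in the kernel, so
  the flex equals that projection.\<close>

lemma inf_rigid_iff_regular:
  fixes p :: "nat \<Rightarrow> real ^ 'd::{finite,linorder}"
  assumes E: "E \<subseteq> polygon_edges n"
  shows "inf_rigid n E p \<longleftrightarrow> regular n E (edge_vector p) p"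
proof
  assume rigid: "inf_rigid n E p"
  show "regular n E (edge_vector p) p"
    unfolding regular_iff
  proof (intro allI impI)
    fix d v
    assume d: "\<forall>r\<in>rigidity_rows E. (\<Sum>v<n. rigidity_row (edge_vector p) p r v \<bullet> d v) = 0" "v < n"
    then have "edge_flex E p d" unfolding edge_flex_iff[OF E] rigidity_rows_def by blast
    then have "trivial_flex n p d" using rigid unfolding inf_rigid_def by blast
    moreover have "(\<Sum>v<n. rigidity_row (edge_vector p) p (Inr (i, j)) v \<bullet> d v) = 0" if "i \<le> j" for i j
      using d(1) that unfolding rigidity_rows_def by blast
    ultimately show "d v = 0" using trivial_orthogonal_zero d(2) by blast
  qed
next
  assume reg: "regular n E (edge_vector p) p"
  show "inf_rigid n E p"
    unfolding inf_rigid_def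
  proof (intro allI impI)
    fix d assume d: "edge_flex E p d"
    let ?K = "{(i, j). (i::'d) \<le> j}" and ?t = "\<lambda>l. rigidity_row (edge_vector p) p (Inr l)"
    obtain c where c: "\<forall>k\<in>?K. (\<Sum>v<n. (d v - (\<Sum>l\<in>?K. c l *\<^sub>R ?t l v)) \<bullet> ?t k v) = 0"
      using projection_exists[where K = ?K and n = n and d = d and t = ?t] by auto
    define w where "w v = (\<Sum>l\<in>?K. c l *\<^sub>R ?t l v)" for v
    have w: "trivial_flex n p w"
      using trivial_rows_trivial_flex[where n = n and p = p and c = c and D = "edge_vector p" and K = ?K] unfolding w_def .
    have flex: "edge_flex E p (\<lambda>v. d v - w v)"
      unfolding edge_flex_def
    proof (intro allI impI)
      fix u v assume uv: "{u, v} \<in> E"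
      then have "u < n" "v < n" using E by (auto simp: polygon_edge_iff dest: subsetD)
      then have "(p u - p v) \<bullet> (w u - w v) = 0" using trivial_flex_edge[OF w] by blast
      moreover have "(p u - p v) \<bullet> (d u - d v) = 0" using d uv unfolding edge_flex_def by blast
      moreover have "(d u - w u) - (d v - w v) = (d u - d v) - (w u - w v)" by simp
      ultimately show "(p u - p v) \<bullet> ((d u - w u) - (d v - w v)) = 0"
        by (simp only: inner_diff_right)
    qed
    have "(\<Sum>v<n. rigidity_row (edge_vector p) p r v \<bullet> (d v - w v)) = 0" if r: "r \<in> rigidity_rows E" for r
    proof (cases r)
      case (Inl e)
      then show ?thesis using flex r unfolding edge_flex_iff[OF E] rigidity_rows_def by blast
    next
      case (Inr k)
      then have "k \<in> ?K" using r unfolding rigidity_rows_def by blast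
      then show ?thesis using c unfolding Inr w_def by (simp only: inner_commute)
    qed
    then have "\<forall>v<n. d v - w v = 0"
      using reg[unfolded regular_iff, THEN spec, of "\<lambda>v. d v - w v"] by blast
    then show "trivial_flex n p d" using w unfolding trivial_flex_def by simp
  qed
qed

subsection \<open>Vertex splitting\<close>

lemma regular_open:
  fixes D :: "real \<Rightarrow> nat set \<Rightarrow> real ^ 'd::{finite,linorder}" and p :: "real \<Rightarrow> nat \<Rightarrow> real ^ 'd::{finite,linorder}"
  assumes "finite E" and count: "2 * card E + CARD('d) * (CARD('d) + 1) = 2 * (n * CARD('d))"
    and reg: "regular n E (D a) (p a)"
    and D: "\<And>e. e \<in> E \<Longrightarrow> ((\<lambda>s. D s e) \<longlongrightarrow> D a e) (at a within S)"
    and p: "\<And>v. v < n \<Longrightarrow> ((\<lambda>s. p s v) \<longlongrightarrow> p a v) (at a within S)"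
  shows "\<forall>\<^sub>F s in at a within S. regular n E (D s) (p s)"
  unfolding regular_def
proof (rule nonsing_open[where M = "\<lambda>s. rigidity_matrix (D s) (p s)"])
  show "finite (rigidity_rows E :: (nat set + 'd \<times> 'd) set)" "finite (rigidity_cols n :: (nat \<times> 'd) set)"
    using assms(1) by (simp_all add: finite_rigidity_rows finite_rigidity_cols)
  show "nonsing (rigidity_rows E) (rigidity_cols n) (rigidity_matrix (D a) (p a))"
    by (rule reg[unfolded regular_def])
  show "card (rigidity_rows E :: (nat set + 'd \<times> 'd) set) = card (rigidity_cols n :: (nat \<times> 'd) set)"
    using card_rigidity_rows[OF assms(1), where 'd = 'd] count unfolding card_rigidity_cols by simp
next
  fix r :: "nat set + 'd \<times> 'd" and c :: "nat \<times> 'd"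
  assume r: "r \<in> rigidity_rows E" and "c \<in> rigidity_cols n"
  then have v: "fst c < n" unfolding rigidity_cols_def by auto
  show "((\<lambda>s. rigidity_matrix (D s) (p s) r c) \<longlongrightarrow> rigidity_matrix (D a) (p a) r c) (at a within S)"
  proof (cases r)
    case (Inl e)
    then have "((\<lambda>s. D s e) \<longlongrightarrow> D a e) (at a within S)" using r D unfolding rigidity_rows_def by blast
    then show ?thesis unfolding Inl rigidity_matrix_def by (auto intro!: tendsto_intros)
  next
    case (Inr k)
    obtain i j where k: "k = (i, j)" by force
    show ?thesis unfolding Inr k rigidity_matrix_def using p[OF v] by (auto intro!: tendsto_intros)
  qed
qed

text \<open>Scaling rows by nonzero factors keeps the kernel. This replaces the artificial direction
  of a collapsed edge by its true edge vector once the ends have been pulled apart along it.\<close>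

lemma regular_scale:
  assumes reg: "regular n E D p" and scale: "\<And>e. e \<in> E \<Longrightarrow> \<exists>c. c \<noteq> 0 \<and> D' e = c *\<^sub>R D e"
  shows "regular n E D' p"
  unfolding regular_iff
proof (intro allI impI)
  fix d v
  assume *: "\<forall>r\<in>rigidity_rows E. (\<Sum>v<n. rigidity_row D' p r v \<bullet> d v) = 0" "v < n"
  have "(\<Sum>v<n. rigidity_row D p r v \<bullet> d v) = 0" if r: "r \<in> rigidity_rows E" for r
  proof (cases r)
    case (Inl e)
    then obtain c where c: "c \<noteq> 0" "D' e = c *\<^sub>R D e"
      using r scale unfolding rigidity_rows_def by blast
    have "rigidity_row D' p r v = c *\<^sub>R rigidity_row D p r v" for v
      unfolding Inl using c(2) by simp
    then have "c * (\<Sum>v<n. rigidity_row D p r v \<bullet> d v) = 0"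
      using bspec[OF *(1) r] by (simp add: sum_distrib_left)
    then show ?thesis using c(1) by simp
  next
    case (Inr k)
    obtain i j where k: "k = (i, j)" by force
    have "rigidity_row D p r = rigidity_row D' p r" unfolding Inr k by (rule ext) simp
    then show ?thesis using bspec[OF *(1) r] by simp
  qed
  then show "d v = 0" using reg *(2) unfolding regular_iff by blast
qed

text \<open>
  Place the vertices \<open>0\<close> and \<open>1\<close> at the position of the glued vertex and give the
  collapsed edge the direction \<open>w\<close>. The common neighbours together with \<open>w\<close> force every
  flex to agree on \<open>0\<close> and \<open>1\<close>, so this degenerate system is nonsingular; it stays so
  after moving vertex \<open>1\<close> a little in direction \<open>w\<close>.
\<close>

lemma vertex_split_rigid:
  fixes p :: "nat \<Rightarrow> real ^ 'd::{finite,linorder}"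
  assumes T: "T \<subseteq> polygon_edges (n + 1)" and e01: "{0, 1} \<in> T" and n: "0 < n"
    and count: "2 * card T + CARD('d) * (CARD('d) + 1) = 2 * ((n + 1) * CARD('d))"
    and Y: "\<And>y. y \<in> Y \<Longrightarrow> 1 < y \<and> {0, y} \<in> T \<and> {1, y} \<in> T"
    and rigid: "inf_rigid n (contract T) p"
    and w: "\<And>g. (\<And>y. y \<in> Y \<Longrightarrow> (p (y - 1) - p 0) \<bullet> g = 0) \<Longrightarrow> w \<bullet> g = 0 \<Longrightarrow> g = 0"
  shows "\<exists>p' :: nat \<Rightarrow> real ^ 'd::{finite,linorder}. inf_rigid (n + 1) T p'"
proof -
  have fin: "finite T" using T finite_polygon_edges finite_subset by blast
  define P where "P s v = (if v = 1 then p 0 + s *\<^sub>R w else p (v - 1))" for s v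
  define D where "D s e = (if e = {0, 1} then w else edge_vector (P s) e)" for s e
  have P0: "P 0 v = p (v - 1)" for v by (simp add: P_def)
  have "regular (n + 1) T (D 0) (P 0)"
    unfolding regular_iff
  proof (intro allI impI)
    fix d v
    assume rows: "\<forall>r\<in>rigidity_rows T. (\<Sum>v<n + 1. rigidity_row (D 0) (P 0) r v \<bullet> d v) = 0" and v: "v < n + 1"
    have row: "D 0 {i, j} \<bullet> (d i - d j) = 0" if ij: "{i, j} \<in> T" "i < j" for i j
    proof -
      have "{i, j} \<in> polygon_edges (n + 1)" using ij(1) T by blast
      then have j: "j < n + 1" by (simp add: polygon_edge_iff)
      have "Inl {i, j} \<in> rigidity_rows T" using ij(1) unfolding rigidity_rows_def by blast
      from bspec[OF rows this] show ?thesis unfolding edge_row_sum[OF ij(2) j] .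
    qed
    have edge: "(p (i - 1) - p (j - 1)) \<bullet> (d i - d j) = 0" if ij: "{i, j} \<in> T" "i < j" "1 < j" for i j
    proof -
      have "{i, j} \<noteq> {0, 1}" using ij by (auto simp: doubleton_eq_iff)
      then have "D 0 {i, j} = p (i - 1) - p (j - 1)"
        using ij(2) by (simp add: D_def edge_vector_pair P0)
      then show ?thesis using row[OF ij(1,2)] by simp
    qed
    have d01: "d 0 = d 1"
    proof -
      have "(p (y - 1) - p 0) \<bullet> (d 0 - d 1) = 0" if "y \<in> Y" for y
      proof -
        have y: "1 < y" "{0, y} \<in> T" "{1, y} \<in> T" using Y[OF that] by auto
        have "(p 0 - p (y - 1)) \<bullet> (d 0 - d y) = 0" "(p 0 - p (y - 1)) \<bullet> (d 1 - d y) = 0"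
          using edge[OF y(2)] edge[OF y(3)] y(1) by simp_all
        then show ?thesis by (simp add: inner_diff_left inner_diff_right)
      qed
      moreover have "w \<bullet> (d 0 - d 1) = 0" using row[OF e01] by (simp add: D_def)
      ultimately show ?thesis using w[of "d 0 - d 1"] by simp
    qed
    \<comment> \<open>The glued vertex receives the common velocity of \<open>0\<close> and
      \<open>1\<close>, the other indices drop by one; \<open>d 0 = d 1\<close> makes this
      compatible with \<open>v \<mapsto> v - 1\<close>.\<close>
    define d' where "d' v = d (v + 1)" for v
    have d': "d' (v - 1) = d v" for v using d01 by (cases v) (auto simp: d'_def)
    have "edge_flex (contract T) p d'"
      unfolding edge_flex_def
    proof (intro allI impI)
      fix a b assume "{a, b} \<in> contract T"
      then obtain e where e: "e \<in> T" "e \<noteq> {0, 1}" "{a, b} = (\<lambda>v. v - 1) ` e" unfolding contract_def by blast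
      have "e \<in> polygon_edges (n + 1)" using e(1) T by blast
      then obtain i j where ij: "e = {i, j}" "i < j" "j < n + 1" by (rule polygon_edgesE)
      have "1 < j" using ij e(2) by (cases "i = 0"; cases "j = 1") auto
      from edge[OF e(1)[unfolded ij(1)] ij(2) this]
      have 1: "(p (i - 1) - p (j - 1)) \<bullet> (d' (i - 1) - d' (j - 1)) = 0" unfolding d' .
      then have 2: "(p (j - 1) - p (i - 1)) \<bullet> (d' (j - 1) - d' (i - 1)) = 0"
        by (simp only: inner_diff_swap)
      have "a = i - 1 \<and> b = j - 1 \<or> a = j - 1 \<and> b = i - 1" using e(3) ij(1) by (auto simp: doubleton_eq_iff)
      then show "(p a - p b) \<bullet> (d' a - d' b) = 0" using 1 2 by blast
    qed
    then obtain A b where A: "linear A" "\<forall>x. A x \<bullet> x = 0" "\<forall>v<n. d' v = A (p v) + b"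
      using rigid unfolding inf_rigid_def trivial_flex_def by blast
    have "d v = A (P 0 v) + b" if "v < n + 1" for v
    proof -
      have "v - 1 < n" using that n by linarith
      then have "d' (v - 1) = A (p (v - 1)) + b" using A(3) by blast
      then show ?thesis unfolding P0 d' .
    qed
    then have "trivial_flex (n + 1) (P 0) d" using A unfolding trivial_flex_def by blast
    moreover have "(\<Sum>v<n + 1. rigidity_row (D 0) (P 0) (Inr (i, j)) v \<bullet> d v) = 0" if "i \<le> j" for i j
      using rows that unfolding rigidity_rows_def by blast
    ultimately show "d v = 0" using trivial_orthogonal_zero v by blast
  qed
  moreover have P: "((\<lambda>s. P s v) \<longlongrightarrow> P 0 v) (at 0)" for v
    unfolding P_def by (cases "v = 1") (auto intro!: tendsto_eq_intros)
  moreover have "((\<lambda>s. D s e) \<longlongrightarrow> D 0 e) (at 0)" for e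
    unfolding D_def edge_vector_def using P by (auto intro!: tendsto_intros)
  ultimately have "\<forall>\<^sub>F s in at 0. regular (n + 1) T (D s) (P s)"
    by (intro regular_open[OF fin count]) auto
  moreover have "\<forall>\<^sub>F s in at 0. s \<noteq> (0::real)" by (simp add: eventually_neq_at_within)
  ultimately have "\<forall>\<^sub>F s in at 0. s \<noteq> (0::real) \<and> regular (n + 1) T (D s) (P s)"
    by eventually_elim simp
  then obtain s where s: "s \<noteq> 0" "regular (n + 1) T (D s) (P s)"
    using eventually_happens'[OF at_neq_bot] by blast
  have "regular (n + 1) T (edge_vector (P s)) (P s)"
  proof (rule regular_scale[OF s(2)])
    fix e
    show "\<exists>c. c \<noteq> 0 \<and> edge_vector (P s) e = c *\<^sub>R D s e"
    proof (cases "e = {0, 1}")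
      case True
      have "edge_vector (P s) {0, 1} = (- s) *\<^sub>R w"
        by (subst edge_vector_pair) (simp_all add: P_def)
      then show ?thesis using s(1) True by (intro exI[of _ "- s"]) (simp add: D_def)
    next
      case False
      then show ?thesis by (intro exI[of _ 1]) (simp add: D_def)
    qed
  qed
  then show ?thesis using inf_rigid_iff_regular[OF T] by blast
qed

text \<open>Rigid positions form an open set, while moving \<open>y\<close> by a nonzero multiple of
  a vector outside \<open>S\<close> leaves the subspace. This brings the directions to the common
  neighbours into general position without losing rigidity.\<close>

lemma perturb_vertex:
  fixes p :: "nat \<Rightarrow> real ^ 'd::{finite,linorder}"
  assumes E: "E \<subseteq> polygon_edges n"
    and count: "2 * card E + CARD('d) * (CARD('d) + 1) = 2 * (n * CARD('d))"
    and rigid: "inf_rigid n E p" and S: "subspace S" "S \<noteq> UNIV"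
  shows "\<exists>q. inf_rigid n E q \<and> (\<forall>v. v \<noteq> y \<longrightarrow> q v = p v) \<and> q y - c \<notin> S"
proof (cases "p y - c \<in> S")
  case True
  obtain z where z: "z \<notin> S" using S(2) by blast
  have fin: "finite E" using E finite_polygon_edges finite_subset by blast
  define P where "P s = p(y := p y + s *\<^sub>R z)" for s
  have P: "((\<lambda>s. P s v) \<longlongrightarrow> P 0 v) (at 0)" for v
    unfolding P_def by (cases "v = y") (auto intro!: tendsto_eq_intros)
  have "\<forall>\<^sub>F s in at 0. regular n E (edge_vector (P s)) (P s)"
  proof (rule regular_open[OF fin count])
    show "regular n E (edge_vector (P 0)) (P 0)"
      using rigid inf_rigid_iff_regular[OF E, of p] by (simp add: P_def)
    show "((\<lambda>s. edge_vector (P s) e) \<longlongrightarrow> edge_vector (P 0) e) (at 0)" for e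
      unfolding edge_vector_def using P by (intro tendsto_intros)
  qed (rule P)
  moreover have "\<forall>\<^sub>F s in at 0. s \<noteq> (0::real)" by (simp add: eventually_neq_at_within)
  ultimately have "\<forall>\<^sub>F s in at 0. s \<noteq> (0::real) \<and> regular n E (edge_vector (P s)) (P s)"
    by eventually_elim simp
  then obtain s where s: "s \<noteq> 0" "regular n E (edge_vector (P s)) (P s)"
    using eventually_happens'[OF at_neq_bot] by blast
  have "P s y - c \<notin> S"
  proof
    assume "P s y - c \<in> S"
    then have "(P s y - c) - (p y - c) \<in> S" using subspace_diff[OF S(1)] True by blast
    then have "s *\<^sub>R z \<in> S" by (simp add: P_def)
    from subspace_scale[OF S(1) this, of "inverse s"] show False using z s(1) by simp
  qed
  then show ?thesis
    using s(2) inf_rigid_iff_regular[OF E, of "P s"] by (intro exI[of _ "P s"]) (auto simp: P_def)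
qed (use rigid in blast)

lemma orthogonal_to_basis:
  fixes u1 u2 u3 w g :: "real ^ 4"
  assumes "u1 \<notin> span {}" "u2 \<notin> span {u1}" "u3 \<notin> span {u2, u1}" "w \<notin> span {u3, u2, u1}"
    and "u1 \<bullet> g = 0" "u2 \<bullet> g = 0" "u3 \<bullet> g = 0" "w \<bullet> g = 0"
  shows "g = 0"
proof -
  let ?B = "{w, u3, u2, u1}"
  have "dim ?B = DIM(real ^ 4)" using assms(1-4) by (simp add: dim_insert)
  then have "span ?B = UNIV" using dim_eq_full by blast
  then have "real_inner_class.orthogonal g g" using assms(5-8)
    by (intro orthogonal_to_span[of g ?B g]) (auto simp: real_inner_class.orthogonal_def inner_commute)
  then show ?thesis by (simp add: real_inner_class.orthogonal_def)
qed

lemma span_3_proper: "span {a, b, c :: real ^ 4} \<noteq> UNIV"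
proof
  assume "span {a, b, c} = UNIV"
  then have "dim {a, b, c} = DIM(real ^ 4)" using dim_eq_full by blast
  moreover have "dim {a, b, c} \<le> card {a, b, c}" by (rule dim_le_card') simp
  moreover have "card {a, b, c} \<le> 3" by (simp add: card_insert_if)
  ultimately show False by simp
qed

section \<open>Relabelling, the simplex, and the induction on the number of vertices\<close>

lemma inf_rigid_relabel:
  fixes p :: "nat \<Rightarrow> real ^ 'd"
  assumes T: "T \<subseteq> polygon_edges n" and bij: "bij_betw \<sigma> {..<n} {..<n}"
    and rigid: "inf_rigid n ((`) \<sigma> ` T) p"
  shows "inf_rigid n T (\<lambda>v. p (\<sigma> v))"
  unfolding inf_rigid_def
proof (intro allI impI)
  fix d assume d: "edge_flex T (\<lambda>v. p (\<sigma> v)) d"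
  define d' where "d' v = d (the_inv_into {..<n} \<sigma> v)" for v
  have d': "d' (\<sigma> v) = d v" if "v < n" for v
    using bij that unfolding d'_def bij_betw_def by (simp add: the_inv_into_f_f)
  have "edge_flex ((`) \<sigma> ` T) p d'"
    unfolding edge_flex_def
  proof (intro allI impI)
    fix a b assume "{a, b} \<in> (`) \<sigma> ` T"
    then obtain e where e: "e \<in> T" "{a, b} = \<sigma> ` e" by blast
    have "e \<in> polygon_edges n" using e(1) T by blast
    then obtain i j where ij: "e = {i, j}" "i < j" "j < n" by (rule polygon_edgesE)
    have dd: "d' (\<sigma> i) = d i" "d' (\<sigma> j) = d j" using d' ij by auto
    have "{i, j} \<in> T" "{j, i} \<in> T" using e(1) ij(1) by (auto simp: insert_commute)
    then have 1: "(p (\<sigma> i) - p (\<sigma> j)) \<bullet> (d' (\<sigma> i) - d' (\<sigma> j)) = 0"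
      and 2: "(p (\<sigma> j) - p (\<sigma> i)) \<bullet> (d' (\<sigma> j) - d' (\<sigma> i)) = 0"
      using d unfolding edge_flex_def dd by blast+
    have "a = \<sigma> i \<and> b = \<sigma> j \<or> a = \<sigma> j \<and> b = \<sigma> i" using e(2) ij(1) by (auto simp: doubleton_eq_iff)
    then show "(p a - p b) \<bullet> (d' a - d' b) = 0" using 1 2 by blast
  qed
  then obtain A b where A: "linear A" "\<forall>x. A x \<bullet> x = 0" "\<forall>v<n. d' v = A (p v) + b"
    using rigid unfolding inf_rigid_def trivial_flex_def by blast
  have "d v = A (p (\<sigma> v)) + b" if "v < n" for v
  proof -
    have "\<sigma> v < n" using bij that by (auto simp: bij_betw_def)
    then show ?thesis using A(3) d'[OF that] by metis
  qed
  then show "trivial_flex n (\<lambda>v. p (\<sigma> v)) d" using A unfolding trivial_flex_def by blast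
qed

text \<open>With vertex \<open>0\<close> at the origin and the others at the unit vectors, the
  velocities relative to vertex \<open>0\<close> are the columns of a matrix. Edges at
  \<open>0\<close> make its diagonal zero, the other edges make it skew, so every flex is
  trivial.\<close>

lemma inf_rigid_simplex:
  "\<exists>p :: nat \<Rightarrow> real ^ 'd. inf_rigid (CARD('d) + 1) (polygon_edges (CARD('d) + 1)) p"
proof -
  obtain \<iota> :: "'d \<Rightarrow> nat" where \<iota>: "bij_betw \<iota> UNIV {0..<CARD('d)}"
    using ex_bij_betw_finite_nat[of "UNIV :: 'd set"] by auto
  define p :: "nat \<Rightarrow> real ^ 'd" where "p v = (\<chi> i. if v = \<iota> i + 1 then 1 else 0)" for v
  have inj: "\<iota> i = \<iota> j \<longleftrightarrow> i = j" for i j using \<iota> by (auto simp: bij_betw_def inj_on_def)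
  have lt: "\<iota> i < CARD('d)" for i using \<iota> by (auto simp: bij_betw_def)
  have p0: "p 0 = 0" and p\<iota>: "p (\<iota> i + 1) = axis i 1" for i
    by (auto simp: p_def Finite_Cartesian_Product.vec_eq_iff axis_def inj)
  have "inf_rigid (CARD('d) + 1) (polygon_edges (CARD('d) + 1)) p"
    unfolding inf_rigid_def
  proof (intro allI impI)
    fix d assume d: "edge_flex (polygon_edges (CARD('d) + 1)) p d"
    define g where "g v = d v - d 0" for v
    define A where "A x = (\<Sum>i\<in>UNIV. x $ i *\<^sub>R g (\<iota> i + 1))" for x :: "real ^ 'd"
    have lin: "linear A"
      unfolding A_def
      by (rule linearI) (simp_all add: scaleR_add_left sum.distrib scaleR_right.sum)
    have diag: "axis i 1 \<bullet> g (\<iota> i + 1) = 0" for i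
    proof -
      have "{\<iota> i + 1, 0} \<in> polygon_edges (CARD('d) + 1)" using lt by (simp add: polygon_edge_iff)
      then have "(p (\<iota> i + 1) - p 0) \<bullet> (d (\<iota> i + 1) - d 0) = 0" using d unfolding edge_flex_def by blast
      then show ?thesis unfolding p0 p\<iota> g_def by simp
    qed
    have skew: "g (\<iota> i + 1) $ j = - g (\<iota> j + 1) $ i" for i j
    proof (cases "i = j")
      case False
      have "{\<iota> i + 1, \<iota> j + 1} \<in> polygon_edges (CARD('d) + 1)"
        using lt[of i] lt[of j] False inj[of i j] by (simp add: polygon_edge_iff)
      then have "(p (\<iota> i + 1) - p (\<iota> j + 1)) \<bullet> (d (\<iota> i + 1) - d (\<iota> j + 1)) = 0"
        using d unfolding edge_flex_def by blast
      moreover have "d (\<iota> i + 1) - d (\<iota> j + 1) = g (\<iota> i + 1) - g (\<iota> j + 1)" by (simp add: g_def)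
      ultimately have "(axis i 1 - axis j 1) \<bullet> (g (\<iota> i + 1) - g (\<iota> j + 1)) = 0" unfolding p\<iota> by simp
      then show ?thesis
        using diag[of i] diag[of j] by (simp add: inner_diff_left inner_diff_right inner_axis')
    qed (use diag[of j] in \<open>simp add: inner_axis'\<close>)
    have "A x \<bullet> x = 0" for x
    proof -
      have "A x \<bullet> x = (\<Sum>i\<in>UNIV. \<Sum>j\<in>UNIV. x $ i * (g (\<iota> i + 1) $ j * x $ j))"
        unfolding A_def inner_sum_left by (simp add: inner_vec_def sum_distrib_left mult.assoc)
      moreover have "\<dots> = (\<Sum>i\<in>UNIV. \<Sum>j\<in>UNIV. x $ j * (g (\<iota> j + 1) $ i * x $ i))"
        by (rule sum.swap)
      moreover have "\<dots> = - (\<Sum>i\<in>UNIV. \<Sum>j\<in>UNIV. x $ i * (g (\<iota> i + 1) $ j * x $ j))"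
      proof -
        have "x $ j * (g (\<iota> j + 1) $ i * x $ i) = - (x $ i * (g (\<iota> i + 1) $ j * x $ j))" for i j
          by (subst skew) simp
        then have "(\<Sum>i\<in>UNIV. \<Sum>j\<in>UNIV. x $ j * (g (\<iota> j + 1) $ i * x $ i)) =
            (\<Sum>i\<in>UNIV. \<Sum>j\<in>UNIV. - (x $ i * (g (\<iota> i + 1) $ j * x $ j)))"
          by (rule sum.cong[OF refl, OF sum.cong[OF refl]])
        then show ?thesis by (simp add: sum_negf)
      qed
      ultimately show ?thesis by linarith
    qed
    moreover have "d v = A (p v) + d 0" if "v < CARD('d) + 1" for v
    proof (cases v)
      case 0
      then show ?thesis by (simp add: p0 linear_0[OF lin])
    next
      case (Suc m)
      then have "m \<in> \<iota> ` UNIV" using \<iota> that by (auto simp: bij_betw_def)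
      then obtain i where i: "m = \<iota> i" by blast
      have "A (axis i 1) = g (\<iota> i + 1)"
        unfolding A_def by (simp add: axis_def if_distrib[of "\<lambda>x. x *\<^sub>R _"] cong: if_cong)
      then have "A (p v) = g v" using p\<iota>[of i] Suc i by simp
      then show ?thesis by (simp add: g_def)
    qed
    ultimately show "trivial_flex (CARD('d) + 1) p d" using lin unfolding trivial_flex_def by blast
  qed
  then show ?thesis by blast
qed

lemma card_polygon_edges: "card (polygon_edges n) = n choose 2"
proof -
  have "polygon_edges n = {K. K \<subseteq> {..<n} \<and> card K = 2}"
    unfolding polygon_edges_def by (auto simp: card_2_iff)
  then show ?thesis using n_subsets[of "{..<n}" 2] by simp
qed

lemma triangulation_rigid_position:
  assumes "n \<ge> 5" "k_triangulation 2 n T"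
  shows "card T + 10 = 4 * n \<and> (\<exists>p :: nat \<Rightarrow> real ^ 4. inf_rigid n T p)"
  using assms
proof (induction n arbitrary: T rule: nat_induct_at_least)
  case base
  have "T = polygon_edges 5"
  proof
    show "T \<subseteq> polygon_edges 5" using base unfolding triangulation_iff by blast
    show "polygon_edges 5 \<subseteq> T"
    proof
      fix e assume "e \<in> polygon_edges 5"
      then obtain i j where ij: "e = {i, j}" "i < j" "j < 5" by (rule polygon_edgesE)
      \<comment> \<open>On five vertices every edge has at most one vertex on one of its
        sides.\<close>
      have "j \<le> i + 2 \<or> i + 5 \<le> j + 2" by linarith
      then show "e \<in> T" unfolding ij(1) using short_edge_mem[OF base ij(2,3)] by blast
    qed
  qed
  moreover have "card (polygon_edges 5) = 10" unfolding card_polygon_edges by (simp add: choose_two)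
  ultimately show ?case using inf_rigid_simplex[where 'd = 4] by simp
next
  case (Suc n)
  have T: "k_triangulation 2 (n + 1) T" using Suc.prems by simp
  have "card T + 10 = 4 * (n + 1) \<and> (\<exists>p :: nat \<Rightarrow> real ^ 4. inf_rigid (n + 1) T p)"
  proof (rule triangulation_rotate_ear[OF T])
    show "6 \<le> n + 1" using Suc.hyps by simp
  next
    fix T assume T: "k_triangulation 2 (n + 1) T" and "{2, n + 1 - 1} \<in> T"
    then have ear: "{2, n} \<in> T" by simp
    obtain x where x: "2 < x" "x < n"
      "{0, 1} \<in> T" "{0, 2} \<in> T" "{1, 2} \<in> T" "{0, n} \<in> T" "{1, n} \<in> T" "{0, x} \<in> T" "{1, x} \<in> T"
      "k_triangulation 2 n (contract T)" "card T = card (contract T) + 4"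
      using contract_ear[OF T Suc.hyps ear] by blast
    have IH: "card (contract T) + 10 = 4 * n" "\<exists>p :: nat \<Rightarrow> real ^ 4. inf_rigid n (contract T) p"
      using Suc.IH[OF x(10)] by blast+
    then obtain p0 :: "nat \<Rightarrow> real ^ 4" where p0: "inf_rigid n (contract T) p0" by blast
    have sub: "contract T \<subseteq> polygon_edges n" "T \<subseteq> polygon_edges (n + 1)"
      using x(10) T unfolding triangulation_iff by blast+
    have count: "2 * card (contract T) + CARD(4) * (CARD(4) + 1) = 2 * (n * CARD(4))" using IH(1) by simp
    have proper: "span {} \<noteq> (UNIV :: (real ^ 4) set)" "span {a} \<noteq> UNIV" "span {a, b} \<noteq> UNIV" for a b :: "real ^ 4"
      using span_3_proper[of a a a] span_3_proper[of a a b] span_mono[of "{}" "{a, a, a}"] by auto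
    \<comment> \<open>The common neighbours \<open>2\<close>, \<open>x\<close>, \<open>n\<close>
      become \<open>1\<close>, \<open>x - 1\<close>, \<open>n - 1\<close>. They are distinct and
      nonzero, so each can be moved out of the span of the previous directions while vertex
      \<open>0\<close> and the earlier ones stay fixed; \<open>w\<close> then completes a
      basis.\<close>
    obtain p1 where p1: "inf_rigid n (contract T) p1" "p1 1 - p0 0 \<notin> span {}" "\<forall>v. v \<noteq> 1 \<longrightarrow> p1 v = p0 v"
      using perturb_vertex[OF sub(1) count p0 subspace_span proper(1), of 1 "p0 0"] by blast
    obtain p2 where p2: "inf_rigid n (contract T) p2" "p2 (x - 1) - p0 0 \<notin> span {p1 1 - p0 0}"
      "\<forall>v. v \<noteq> x - 1 \<longrightarrow> p2 v = p1 v"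
      using perturb_vertex[OF sub(1) count p1(1) subspace_span proper(2), of "x - 1" "p0 0"] by blast
    obtain p3 where p3: "inf_rigid n (contract T) p3"
      "p3 (n - 1) - p0 0 \<notin> span {p2 (x - 1) - p0 0, p1 1 - p0 0}" "\<forall>v. v \<noteq> n - 1 \<longrightarrow> p3 v = p2 v"
      using perturb_vertex[OF sub(1) count p2(1) subspace_span proper(3), of "n - 1" "p0 0"] by blast
    obtain w where w: "w \<notin> span {p3 (n - 1) - p0 0, p2 (x - 1) - p0 0, p1 1 - p0 0}"
      using span_3_proper by blast
    have eq: "p3 0 = p0 0" "p3 1 = p1 1" "p3 (x - 1) = p2 (x - 1)"
      using p1(3) p2(3) p3(3) x(1,2) by auto
    have "\<exists>p' :: nat \<Rightarrow> real ^ 4. inf_rigid (n + 1) T p'"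
    proof (rule vertex_split_rigid[OF sub(2) x(3) _ _ _ p3(1), of "{2, x, n}" w])
      show "2 * card T + CARD(4) * (CARD(4) + 1) = 2 * ((n + 1) * CARD(4))" using IH(1) x(11) by simp
      show "1 < y \<and> {0, y} \<in> T \<and> {1, y} \<in> T" if "y \<in> {2, x, n}" for y
        using that x by auto
      fix g assume g: "\<And>y. y \<in> {2, x, n} \<Longrightarrow> (p3 (y - 1) - p3 0) \<bullet> g = 0" "w \<bullet> g = 0"
      have "(p1 1 - p0 0) \<bullet> g = 0" "(p2 (x - 1) - p0 0) \<bullet> g = 0" "(p3 (n - 1) - p0 0) \<bullet> g = 0"
        using g(1)[of 2] g(1)[of x] g(1)[of n] eq by simp_all
      then show "g = 0" using orthogonal_to_basis[OF p1(2) p2(2) p3(2) w] g(2) by blast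
    qed (use x in simp)
    then show "card T + 10 = 4 * (n + 1) \<and> (\<exists>p :: nat \<Rightarrow> real ^ 4. inf_rigid (n + 1) T p)"
      using IH(1) x(11) by simp
  next
    fix T
    let ?R = "(`) (rot (n + 1)) ` T"
    assume T: "k_triangulation 2 (n + 1) T"
      and R: "card ?R + 10 = 4 * (n + 1) \<and> (\<exists>p :: nat \<Rightarrow> real ^ 4. inf_rigid (n + 1) ?R p)"
    have sub: "T \<subseteq> polygon_edges (n + 1)" using T unfolding triangulation_iff by blast
    then have "T \<subseteq> Pow {..<n + 1}" unfolding polygon_edges_def by auto
    moreover have "inj_on ((`) (rot (n + 1))) (Pow {..<n + 1})"
      using bij_betw_rot[of "n + 1"] by (intro inj_on_image_Pow) (simp add: bij_betw_def)
    ultimately have "card ?R = card T" by (metis card_image inj_on_subset)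
    then show "card T + 10 = 4 * (n + 1) \<and> (\<exists>p :: nat \<Rightarrow> real ^ 4. inf_rigid (n + 1) T p)"
      using R inf_rigid_relabel[OF sub bij_betw_rot] by metis
  qed
  then show ?case by simp
qed

subsection \<open>Generic frameworks are rigid\<close>

text \<open>Each matrix entry is an integer combination of coordinates and constants, so the
  determinant is a rational polynomial in the coordinates, nonzero at \<open>p0\<close> and hence at
  \<open>p\<close>.\<close>

lemma generic_inf_rigid:
  fixes p p0 :: "nat \<Rightarrow> real ^ 'd::{finite,linorder}"
  assumes E: "E \<subseteq> polygon_edges n"
    and count: "2 * card E + CARD('d) * (CARD('d) + 1) = 2 * (n * CARD('d))"
    and rigid: "inf_rigid n E p0" and gen: "generic_embedding {0..<n} p"
  shows "inf_rigid n E p"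
proof -
  have fin: "finite E" using E finite_polygon_edges finite_subset by blast
  define q :: "(nat \<times> 'd \<Rightarrow> real) \<Rightarrow> nat \<Rightarrow> real ^ 'd::{finite,linorder}" where
    "q x v = (\<chi> k. x (v, k))" for x v
  define M where "M x = rigidity_matrix (edge_vector (q x)) (q x)" for x
  let ?I = "{0..<n} \<times> (UNIV :: 'd set)"
  have var: "polyfun ?I (\<lambda>x. x (v, k))" if "v < n" for v k
    using that by (intro polyfun_var) simp
  have "nonsing (rigidity_rows E) (rigidity_cols n) (M (\<lambda>(v, i). p v $ i))"
  proof (rule nonsing_generic[where M = M])
    show "finite (rigidity_rows E :: (nat set + 'd \<times> 'd) set)" "finite (rigidity_cols n :: (nat \<times> 'd) set)"
      using fin by (simp_all add: finite_rigidity_rows finite_rigidity_cols)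
    show "card (rigidity_rows E :: (nat set + 'd \<times> 'd) set) = card (rigidity_cols n :: (nat \<times> 'd) set)"
      using card_rigidity_rows[OF fin, where 'd = 'd] count unfolding card_rigidity_cols by simp
    have "q (\<lambda>(v, i). p0 v $ i) = p0" unfolding q_def by simp
    then show "nonsing (rigidity_rows E) (rigidity_cols n) (M (\<lambda>(v, i). p0 v $ i))"
      using rigid inf_rigid_iff_regular[OF E, of p0] unfolding regular_def M_def by simp
    show "algebraically_independent ?I (\<lambda>(v, i). p v $ i)"
      using gen unfolding generic_embedding_def .
  next
    fix r :: "nat set + 'd \<times> 'd" and c :: "nat \<times> 'd"
    assume r: "r \<in> rigidity_rows E" and "c \<in> rigidity_cols n"
    then have c: "fst c < n" unfolding rigidity_cols_def by auto
    show "polyfun ?I (\<lambda>x. M x r c)"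
    proof (cases r)
      case (Inl e)
      then have "e \<in> polygon_edges n" using r E unfolding rigidity_rows_def by blast
      then obtain i j where ij: "e = {i, j}" "i < j" "j < n" by (rule polygon_edgesE)
      have "M x r c = (if fst c = i then x (i, snd c) - x (j, snd c) else
          if fst c = j then x (j, snd c) - x (i, snd c) else 0)" for x
        using ij(2) unfolding M_def rigidity_matrix_def Inl ij(1) by (auto simp: edge_vector_pair q_def)
      moreover have "i < n" using ij by simp
      ultimately show ?thesis
        using var ij(3) by (simp only:) (intro polyfun_if polyfun_minus polyfun_0; blast)
    next
      case (Inr k)
      obtain i j where k: "k = (i, j)" by force
      have "M x r c = (if i = j then (if snd c = i then of_int 1 else 0)
         else (if snd c = j then x (fst c, i) else 0) - (if snd c = i then x (fst c, j) else 0))" for x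
        unfolding M_def rigidity_matrix_def Inr k by (auto simp: q_def axis_def)
      then show ?thesis
        using var[OF c] by (simp only:) (intro polyfun_if polyfun_minus polyfun_0 polyfun_of_int; blast)
    qed
  qed
  moreover have "q (\<lambda>(v, i). p v $ i) = p" unfolding q_def by simp
  ultimately show ?thesis using inf_rigid_iff_regular[OF E, of p] unfolding regular_def M_def by simp
qed

text \<open>
  The matrix \<open>L\<close> produces coordinates with respect to \<open>p (\<sigma> i) - p 0\<close> that are
  linear in the vector, which makes the isometry between congruent configurations linear.
\<close>

definition affinely_spanning :: "nat \<Rightarrow> (nat \<Rightarrow> real ^ 'd) \<Rightarrow> bool" where
  "affinely_spanning n p \<longleftrightarrow> (\<exists>(\<sigma> :: 'd \<Rightarrow> nat) L. (\<forall>i. \<sigma> i < n) \<and>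
     (\<forall>w. (\<Sum>i\<in>UNIV. (\<Sum>k\<in>UNIV. L i k * w $ k) *\<^sub>R (p (\<sigma> i) - p 0)) = w))"

text \<open>The determinant of the vectors from vertex \<open>0\<close> to \<open>CARD('d)\<close>
  further vertices is a rational polynomial that does not vanish at the standard simplex.\<close>

lemma generic_affinely_spanning:
  fixes p :: "nat \<Rightarrow> real ^ 'd"
  assumes n: "CARD('d) < n" and gen: "generic_embedding {0..<n} p"
  shows "affinely_spanning n p"
proof -
  obtain \<iota> :: "'d \<Rightarrow> nat" where \<iota>: "bij_betw \<iota> UNIV {0..<CARD('d)}"
    using ex_bij_betw_finite_nat[of "UNIV :: 'd set"] by auto
  have inj: "\<iota> i = \<iota> j \<longleftrightarrow> i = j" for i j using \<iota> by (auto simp: bij_betw_def inj_on_def)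
  have "\<iota> i < CARD('d)" for i using \<iota> by (auto simp: bij_betw_def)
  then have lt: "\<iota> i + 1 < n" for i using n by (metis Suc_eq_plus1 Suc_leI le_less_trans)
  define M where "M x k i = x (\<iota> i + 1, k) - x (0, k)" for x :: "nat \<times> 'd \<Rightarrow> real" and k i
  have "nonsing UNIV UNIV (M (\<lambda>(v, i). p v $ i))"
  proof (rule nonsing_generic[where M = M])
    show "nonsing UNIV UNIV (M (\<lambda>(v, k). if v = \<iota> k + 1 then 1 else 0))"
      unfolding nonsing_def M_def by (simp add: inj if_distrib[of "\<lambda>x. x * _"] cong: if_cong)
    show "algebraically_independent ({0..<n} \<times> UNIV) (\<lambda>(v, i). p v $ i)"
      using gen unfolding generic_embedding_def .
    show "polyfun ({0..<n} \<times> UNIV) (\<lambda>x. M x k i)" for k i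
      unfolding M_def using lt[of i] by (intro polyfun_minus polyfun_var) auto
  qed simp_all
  then obtain L where L: "\<And>y k. (\<Sum>i\<in>UNIV. M (\<lambda>(v, i). p v $ i) k i * (\<Sum>k'\<in>UNIV. L i k' * y k')) = y k"
    using nonsing_right_inverse[of UNIV UNIV "M (\<lambda>(v, i). p v $ i)"] by auto
  have "(\<Sum>i\<in>UNIV. (\<Sum>k\<in>UNIV. L i k * w $ k) *\<^sub>R (p (\<iota> i + 1) - p 0)) = w" for w
    unfolding Finite_Cartesian_Product.vec_eq_iff
  proof
    fix k show "(\<Sum>i\<in>UNIV. (\<Sum>k\<in>UNIV. L i k * w $ k) *\<^sub>R (p (\<iota> i + 1) - p 0)) $ k = w $ k"
      using L[of k "\<lambda>k. w $ k"] by (simp add: M_def mult.commute)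
  qed
  then show ?thesis unfolding affinely_spanning_def using lt by (intro exI[of _ "\<lambda>i. \<iota> i + 1"]) blast
qed

section \<open>Congruent configurations and transport along isometries\<close>

lemma inner_from_dist:
  fixes a b :: "'a::real_inner"
  shows "a \<bullet> b = ((dist a 0)\<^sup>2 + (dist b 0)\<^sup>2 - (dist a b)\<^sup>2) / 2"
  by (simp add: dist_norm power2_norm_eq_inner inner_diff_left inner_diff_right inner_commute)

text \<open>Equal distances give equal Gram matrices relative to vertex \<open>0\<close>. Copying
  coordinates from the vectors \<open>x (\<sigma> i)\<close> to the vectors
  \<open>y (\<sigma> i)\<close> is therefore an inner-product preserving linear map.\<close>

lemma congruent_isometry:
  fixes p q :: "nat \<Rightarrow> real ^ 'd"
  assumes span: "affinely_spanning n p" and n: "0 < n"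
    and dist: "\<And>u v. u < n \<Longrightarrow> v < n \<Longrightarrow> dist (q u) (q v) = dist (p u) (p v)"
  shows "\<exists>R c. orthogonal_transformation R \<and> (\<forall>v<n. q v = R (p v) + c)"
proof -
  obtain \<sigma> :: "'d \<Rightarrow> nat" and L where \<sigma>: "\<And>i. \<sigma> i < n"
    and L: "\<And>w. (\<Sum>i\<in>UNIV. (\<Sum>k\<in>UNIV. L i k * w $ k) *\<^sub>R (p (\<sigma> i) - p 0)) = w"
    using span unfolding affinely_spanning_def by blast
  define \<alpha> where "\<alpha> w i = (\<Sum>k\<in>UNIV. L i k * w $ k)" for w :: "real ^ 'd" and i
  define x where "x v = p v - p 0" for v
  define y where "y v = q v - q 0" for v
  define R where "R w = (\<Sum>i\<in>UNIV. \<alpha> w i *\<^sub>R y (\<sigma> i))" for w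
  have w: "(\<Sum>i\<in>UNIV. \<alpha> w i *\<^sub>R x (\<sigma> i)) = w" for w
    using L[of w] unfolding \<alpha>_def x_def .
  have gram: "y u \<bullet> y v = x u \<bullet> x v" if "u < n" "v < n" for u v
  proof -
    have "dist (y u) 0 = dist (x u) 0" "dist (y v) 0 = dist (x v) 0" "dist (y u) (y v) = dist (x u) (x v)"
      using dist[OF that] dist[OF that(1) n] dist[OF that(2) n] by (simp_all add: x_def y_def dist_norm)
    then show ?thesis by (simp add: inner_from_dist)
  qed
  have "linear R"
    unfolding R_def \<alpha>_def
    by (rule linearI)
      (simp_all add: distrib_left sum.distrib scaleR_add_left scaleR_right.sum sum_distrib_left mult_ac)
  moreover have inner: "R v \<bullet> R w = v \<bullet> w" for v w
  proof -
    have "R v \<bullet> R w = (\<Sum>j\<in>UNIV. \<Sum>i\<in>UNIV. \<alpha> w j * (\<alpha> v i * (y (\<sigma> i) \<bullet> y (\<sigma> j))))"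
      unfolding R_def inner_sum_left inner_sum_right by (simp add: sum_distrib_left)
    also have "\<dots> = (\<Sum>i\<in>UNIV. \<alpha> v i *\<^sub>R x (\<sigma> i)) \<bullet> (\<Sum>i\<in>UNIV. \<alpha> w i *\<^sub>R x (\<sigma> i))"
      unfolding gram[OF \<sigma> \<sigma>] inner_sum_left inner_sum_right by (simp add: sum_distrib_left)
    finally show ?thesis unfolding w .
  qed
  ultimately have "orthogonal_transformation R" unfolding orthogonal_transformation_def by blast
  moreover have "q v = R (p v) + (q 0 - R (p 0))" if v: "v < n" for v
  proof -
    have "R (x v) \<bullet> y v = (\<Sum>i\<in>UNIV. \<alpha> (x v) i *\<^sub>R x (\<sigma> i)) \<bullet> x v"
      unfolding R_def inner_sum_left by (simp add: gram[OF \<sigma> v])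
    then have "R (x v) \<bullet> y v = x v \<bullet> x v" unfolding w .
    \<comment> \<open>The vertex \<open>v\<close> need not be among the spanning ones, so agreement
      there is obtained by showing that the error has length zero.\<close>
    then have "(R (x v) - y v) \<bullet> (R (x v) - y v) = 0"
      by (simp add: inner_diff_left inner_diff_right inner gram[OF v v] inner_commute)
    then have "R (p v - p 0) = q v - q 0" by (simp add: x_def y_def)
    then show ?thesis using linear_diff[OF \<open>linear R\<close>] by (simp add: algebra_simps)
  qed
  ultimately show ?thesis by blast
qed

lemma orthogonal_euclidean_isometry:
  fixes R :: "real ^ 'd \<Rightarrow> real ^ 'd"
  assumes "orthogonal_transformation R"
  shows "euclidean_isometry (\<lambda>x. R x + c)"
proof -
  have "bij ((\<lambda>x. x + c) \<circ> R)"
    using orthogonal_transformation_bij[OF assms] bij_plus_right by (rule bij_comp)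
  moreover have "dist (R x + c) (R y + c) = dist x y" for x y
    using assms unfolding orthogonal_transformation_isometry by simp
  ultimately show ?thesis unfolding euclidean_isometry_def comp_def by blast
qed

text \<open>Flexes are pulled back by the inverse \<open>S\<close> of \<open>R\<close>; conjugating
  the skew map \<open>A\<close> by \<open>R\<close> keeps it skew, and the translation
  \<open>c\<close> only changes the constant term.\<close>

lemma inf_rigid_isometry:
  fixes p q :: "nat \<Rightarrow> real ^ 'd"
  assumes E: "E \<subseteq> polygon_edges n" and rigid: "inf_rigid n E p"
    and R: "orthogonal_transformation R" and q: "\<And>v. v < n \<Longrightarrow> q v = R (p v) + c"
  shows "inf_rigid n E q"
  unfolding inf_rigid_def
proof (intro allI impI)
  fix d assume d: "edge_flex E q d"
  define S where "S = inv_into UNIV R"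
  have S: "orthogonal_transformation S" unfolding S_def by (rule orthogonal_transformation_inv[OF R])
  have RS: "R (S x) = x" "S (R x) = x" for x
    using orthogonal_transformation_bij[OF R] unfolding S_def
    by (simp_all add: bij_is_surj surj_f_inv_f bij_is_inj inv_f_f)
  have lin: "linear R" "linear S" using R S by (simp_all add: orthogonal_transformation_linear)
  have R_inner: "R x \<bullet> R y = x \<bullet> y" for x y using R unfolding orthogonal_transformation_def by blast
  have "edge_flex E p (\<lambda>v. S (d v))"
    unfolding edge_flex_def
  proof (intro allI impI)
    fix u v assume uv: "{u, v} \<in> E"
    then have "{u, v} \<in> polygon_edges n" using E by blast
    then have lt: "u < n" "v < n" by (simp_all add: polygon_edge_iff)
    have "(p u - p v) \<bullet> (S (d u) - S (d v)) = R (p u - p v) \<bullet> R (S (d u) - S (d v))" by (simp only: R_inner)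
    also have "\<dots> = (q u - q v) \<bullet> (d u - d v)" by (simp add: linear_diff[OF lin(1)] RS q lt)
    also have "\<dots> = 0" using d uv unfolding edge_flex_def by blast
    finally show "(p u - p v) \<bullet> (S (d u) - S (d v)) = 0" .
  qed
  then obtain A b where A: "linear A" "\<And>x. A x \<bullet> x = 0" "\<And>v. v < n \<Longrightarrow> S (d v) = A (p v) + b"
    using rigid unfolding inf_rigid_def trivial_flex_def by blast
  have "linear (R \<circ> A \<circ> S)" using A(1) lin by (intro linear_compose)
  moreover have "(R \<circ> A \<circ> S) x \<bullet> x = 0" for x
    using R_inner[of "A (S x)" "S x"] A(2)[of "S x"] by (simp add: RS)
  moreover have "d v = (R \<circ> A \<circ> S) (q v) + (R b - R (A (S c)))" if "v < n" for v
  proof -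
    have "d v = R (A (p v) + b)" using A(3)[OF that] RS(1)[of "d v"] by simp
    moreover have "S (q v) = p v + S c" using q[OF that] by (simp add: linear_add[OF lin(2)] RS)
    ultimately show ?thesis by (simp add: linear_add[OF lin(1)] linear_add[OF A(1)])
  qed
  ultimately show "trivial_flex n q d" unfolding trivial_flex_def by blast
qed

text \<open>
  If corresponding edges of \<open>x\<close> and \<open>y\<close> have equal lengths, then \<open>y - x\<close> is an
  infinitesimal flex of the average \<open>(x + y) / 2\<close>. Near a congruent copy of \<open>p\<close> this
  average is still infinitesimally rigid, so the flex is trivial and all distances of \<open>x\<close>
  and \<open>y\<close> agree: the times at which the motion is congruent to \<open>p\<close> form a clopen set.
\<close>

lemma inf_rigid_framework:
  fixes p :: "nat \<Rightarrow> real ^ 'd::{finite,linorder}"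
  assumes E: "E \<subseteq> polygon_edges n" and n: "0 < n"
    and count: "2 * card E + CARD('d) * (CARD('d) + 1) = 2 * (n * CARD('d))"
    and rigid: "inf_rigid n E p" and span: "affinely_spanning n p"
  shows "rigid_framework {0..<n} E p"
  unfolding rigid_framework_def
proof (intro allI impI ballI)
  fix q and t :: real
  assume q: "framework_motion {0..<n} E p q" and t: "t \<in> {0..1}"
  have cont: "continuous_on {0..1} (\<lambda>t. q t v)" if "v < n" for v
    using q that unfolding framework_motion_def by simp
  have q0: "q 0 v = p v" if "v < n" for v using q that unfolding framework_motion_def by simp
  have edge: "dist (q t u) (q t v) = dist (p u) (p v)" if "t \<in> {0..1}" "{u, v} \<in> E" for t u v
  proof -
    have "{u, v} \<in> polygon_edges n" using E that by blast
    then have "u < n" "v < n" by (simp_all add: polygon_edge_iff)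
    then show ?thesis using q that unfolding framework_motion_def by simp
  qed
  have fin: "finite E" using E finite_polygon_edges finite_subset by blast
  define C where "C = {t \<in> {0..1}. \<forall>u<n. \<forall>v<n. dist (q t u) (q t v) = dist (p u) (p v)}"
  have "closedin (top_of_set {0..1}) C"
  proof -
    have "closedin (top_of_set {0..1}) {t \<in> {0..1}. dist (q t u) (q t v) = dist (p u) (p v)}"
      if "u < n" "v < n" for u v
      using cont that by (intro continuous_closedin_preimage_constant continuous_on_dist) auto
    then have "closedin (top_of_set {0..1})
      (\<Inter>(u, v)\<in>{..<n} \<times> {..<n}. {t \<in> {0..1}. dist (q t u) (q t v) = dist (p u) (p v)})"
      using n by (intro closedin_INT) auto
    moreover have "(\<Inter>(u, v)\<in>{..<n} \<times> {..<n}. {t \<in> {0..1}. dist (q t u) (q t v) = dist (p u) (p v)}) = C"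
      using n unfolding C_def by auto
    ultimately show ?thesis by simp
  qed
  moreover have "openin (top_of_set {0..1}) C"
    unfolding openin_euclidean_subtopology_iff
  proof (intro conjI ballI)
    show "C \<subseteq> {0..1}" unfolding C_def by blast
    fix a assume a: "a \<in> C"
    then have a01: "a \<in> {0..1}" unfolding C_def by blast
    have "\<exists>R c. orthogonal_transformation R \<and> (\<forall>v<n. q a v = R (p v) + c)"
      using a unfolding C_def by (intro congruent_isometry[OF span n]) auto
    then have "inf_rigid n E (q a)" using inf_rigid_isometry[OF E rigid] by blast
    define m where "m s v = (1 / 2) *\<^sub>R (q a v + q s v)" for s v
    have ma: "m a = q a" unfolding m_def by (rule ext) (simp add: scaleR_2[symmetric])
    have m: "((\<lambda>s. m s v) \<longlongrightarrow> m a v) (at a within {0..1})" if "v < n" for v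
      using cont[OF that] a01 unfolding m_def continuous_on_def by (intro tendsto_intros) blast
    have "\<forall>\<^sub>F s in at a within {0..1}. regular n E (edge_vector (m s)) (m s)"
    proof (rule regular_open[OF fin count _ _ m])
      show "regular n E (edge_vector (m a)) (m a)"
        using \<open>inf_rigid n E (q a)\<close> inf_rigid_iff_regular[OF E] unfolding ma by blast
      fix e assume "e \<in> E"
      then have "e \<in> polygon_edges n" using E by blast
      then obtain i j where ij: "e = {i, j}" "i < j" "j < n" by (rule polygon_edgesE)
      then show "((\<lambda>s. edge_vector (m s) e) \<longlongrightarrow> edge_vector (m a) e) (at a within {0..1})"
        using m by (simp add: edge_vector_pair tendsto_diff)
    qed
    then have "\<forall>\<^sub>F s in at a within {0..1}. s \<in> {0..1} \<longrightarrow> s \<in> C"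
    proof eventually_elim
      case (elim s)
      then have rigid: "inf_rigid n E (m s)" using inf_rigid_iff_regular[OF E] by blast
      \<comment> \<open>This is
        \<open>(X + Y) \<bullet> (X - Y) = X \<bullet> X - Y \<bullet> Y\<close>, used in both
        directions: equal edge lengths give a flex of the average, and triviality of the flex gives
        equal distances for all pairs.\<close>
      have half: "(m s u - m s v) \<bullet> ((q s u - q a u) - (q s v - q a v)) =
        ((dist (q s u) (q s v))\<^sup>2 - (dist (q a u) (q a v))\<^sup>2) / 2" for u v
      proof -
        define X where "X = q s u - q s v"
        define Y where "Y = q a u - q a v"
        have "m s u - m s v = (1 / 2) *\<^sub>R (X + Y)"
          unfolding m_def X_def Y_def by (simp add: algebra_simps)
        moreover have "(q s u - q a u) - (q s v - q a v) = X - Y" unfolding X_def Y_def by simp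
        moreover have "(X + Y) \<bullet> (X - Y) = X \<bullet> X - Y \<bullet> Y"
          by (simp add: inner_add_left inner_diff_right inner_commute[of Y X])
        ultimately show ?thesis
          by (simp add: dist_norm power2_norm_eq_inner X_def[symmetric] Y_def[symmetric])
      qed
      show ?case
      proof
        assume s: "s \<in> {0..1}"
        have "edge_flex E (m s) (\<lambda>v. q s v - q a v)"
          unfolding edge_flex_def half using edge s a01 by simp
        then have triv: "trivial_flex n (m s) (\<lambda>v. q s v - q a v)" using rigid unfolding inf_rigid_def by blast
        have "dist (q s u) (q s v) = dist (p u) (p v)" if "u < n" "v < n" for u v
        proof -
          have "(dist (q s u) (q s v))\<^sup>2 = (dist (q a u) (q a v))\<^sup>2"
            using trivial_flex_edge[OF triv that] unfolding half by simp
          then have "dist (q s u) (q s v) = dist (q a u) (q a v)" by simp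
          then show ?thesis using a that unfolding C_def by simp
        qed
        then show "s \<in> C" using s unfolding C_def by blast
      qed
    qed
    then obtain e where e: "e > 0" "\<And>s. s \<in> {0..1} \<Longrightarrow> s \<noteq> a \<Longrightarrow> dist s a < e \<Longrightarrow> s \<in> C"
      unfolding eventually_at by blast
    show "\<exists>e>0. \<forall>s\<in>{0..1}. dist s a < e \<longrightarrow> s \<in> C"
      using e a by (intro exI[of _ e]) blast
  qed
  ultimately have "C = {} \<or> C = {0..1}"
    using connected_clopen[of "{0..1::real}"] by simp
  moreover have "0 \<in> C" unfolding C_def using q0 by simp
  ultimately have "t \<in> C" using t by blast
  then have "\<exists>R c. orthogonal_transformation R \<and> (\<forall>v<n. q t v = R (p v) + c)"
    unfolding C_def by (intro congruent_isometry[OF span n]) auto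
  then obtain R c where "orthogonal_transformation R" "\<forall>v<n. q t v = R (p v) + c" by blast
  then show "\<exists>h. euclidean_isometry h \<and> (\<forall>v\<in>{0..<n}. q t v = h (p v))"
    using orthogonal_euclidean_isometry by (intro exI[of _ "\<lambda>x. R x + c"]) simp
qed

subsection \<open>Deleting an edge creates a flex\<close>

text \<open>
  Picard iteration for \<open>D = s l + Q D\<close>: for small \<open>s\<close> the right-hand side is a
  contraction of a small ball, and the limit is uniform in \<open>s\<close>.
\<close>

lemma quadratic_path:
  fixes l :: "'c \<Rightarrow> real" and Q :: "('c \<Rightarrow> real) \<Rightarrow> 'c \<Rightarrow> real"
  assumes C: "finite C" and K: "K > 0" and l: "\<And>c. c \<in> C \<Longrightarrow> \<bar>l c\<bar> \<le> K"
    and Q0: "\<And>c. c \<in> C \<Longrightarrow> Q (\<lambda>_. 0) c = 0"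
    and lip: "\<And>x y \<delta> \<eta> c. c \<in> C \<Longrightarrow> 0 \<le> \<delta> \<Longrightarrow> 0 \<le> \<eta> \<Longrightarrow>
      (\<And>a. a \<in> C \<Longrightarrow> \<bar>x a\<bar> \<le> \<delta> \<and> \<bar>y a\<bar> \<le> \<delta> \<and> \<bar>x a - y a\<bar> \<le> \<eta>) \<Longrightarrow>
      \<bar>Q x c - Q y c\<bar> \<le> K * \<delta> * \<eta>"
    and cont: "\<And>(x :: real \<Rightarrow> 'c \<Rightarrow> real) X c. c \<in> C \<Longrightarrow>
      (\<And>a. a \<in> C \<Longrightarrow> continuous_on X (\<lambda>s. x s a)) \<Longrightarrow> continuous_on X (\<lambda>s. Q (x s) c)"
  obtains \<epsilon> D where "\<epsilon> > 0" "\<And>c. c \<in> C \<Longrightarrow> continuous_on {0..\<epsilon>} (\<lambda>s. D s c)"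
    "\<And>c. c \<in> C \<Longrightarrow> D 0 c = 0"
    "\<And>s c. s \<in> {0..\<epsilon>} \<Longrightarrow> c \<in> C \<Longrightarrow> D s c = s * l c + Q (D s) c"
proof -
  \<comment> \<open>On the ball of radius \<open>\<delta>\<close> the Lipschitz constant of
    \<open>Q\<close> is \<open>K * \<delta> = 1 / 4\<close>. The linear term is at most
    \<open>\<epsilon> * K = \<delta> / 2\<close> and \<open>Q\<close> at most
    \<open>\<delta> / 4\<close>, so the iteration stays in the ball.\<close>
  define \<epsilon> where "\<epsilon> = 1 / (8 * K\<^sup>2)"
  define \<delta> where "\<delta> = 1 / (4 * K)"
  have \<delta>: "0 < \<delta>" "K * \<delta> = 1 / 4" and \<epsilon>: "0 < \<epsilon>" "\<epsilon> * K = \<delta> / 2"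
    using K by (simp_all add: \<delta>_def \<epsilon>_def power2_eq_square field_simps)
  define X where "X = rec_nat (\<lambda>s c. 0) (\<lambda>_ x s c. s * l c + Q (x s) c)"
  have X0: "X 0 = (\<lambda>s c. 0)" and XS: "X (Suc k) s c = s * l c + Q (X k s) c" for k s c
    by (simp_all add: X_def)
  have lin: "\<bar>s * l c\<bar> \<le> \<delta> / 2" if "s \<in> {0..\<epsilon>}" "c \<in> C" for s c
  proof -
    have "\<bar>s * l c\<bar> \<le> \<epsilon> * K"
      unfolding abs_mult using that l[OF that(2)] \<epsilon>(1) by (intro mult_mono) auto
    then show ?thesis using \<epsilon>(2) by simp
  qed
  have bound: "\<bar>X k s c\<bar> \<le> \<delta>" if "s \<in> {0..\<epsilon>}" "c \<in> C" for k s c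
    using that(2)
  proof (induction k arbitrary: c)
    case 0
    then show ?case using \<delta>(1) by (simp add: X0)
  next
    case (Suc k)
    have "\<bar>Q (X k s) c - Q (\<lambda>_. 0) c\<bar> \<le> K * \<delta> * \<delta>"
      using Suc \<delta>(1) by (intro lip) auto
    then have "\<bar>Q (X k s) c\<bar> \<le> \<delta> / 4" unfolding Q0[OF Suc.prems] \<delta>(2) by simp
    then show ?case using lin[OF that(1) Suc.prems] \<delta>(1) unfolding XS by linarith
  qed
  have contr: "\<bar>X (Suc k) s c - X k s c\<bar> \<le> \<delta> * (1 / 4) ^ k" if "s \<in> {0..\<epsilon>}" "c \<in> C" for k s c
    using that(2)
  proof (induction k arbitrary: c)
    case 0
    then show ?case using bound[OF that(1) 0, of 1] by (simp add: X0)
  next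
    case (Suc k)
    have "\<bar>Q (X (Suc k) s) c - Q (X k s) c\<bar> \<le> K * \<delta> * (\<delta> * (1 / 4) ^ k)"
      using Suc \<delta>(1) bound[OF that(1)] by (intro lip) auto
    then show ?case unfolding XS[of "Suc k"] XS[of k] \<delta>(2) by simp
  qed
  have X_cont: "continuous_on {0..\<epsilon>} (\<lambda>s. X k s c)" if "c \<in> C" for k c
    using that
  proof (induction k arbitrary: c)
    case 0
    then show ?case by (simp add: X0)
  next
    case (Suc k)
    have "continuous_on {0..\<epsilon>} (\<lambda>s. Q (X k s) c)" using Suc by (intro cont) auto
    then show ?case unfolding XS by (intro continuous_intros)
  qed
  define D where "D s c = suminf (\<lambda>k. X (Suc k) s c - X k s c)" for s c
  have unif: "uniform_limit {0..\<epsilon>} (\<lambda>k s. X k s c) (\<lambda>s. D s c) sequentially" if c: "c \<in> C" for c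
  proof -
    have "uniform_limit {0..\<epsilon>} (\<lambda>m s. \<Sum>k<m. X (Suc k) s c - X k s c) (\<lambda>s. D s c) sequentially"
      unfolding D_def
    proof (rule Weierstrass_m_test)
      show "norm (X (Suc k) s c - X k s c) \<le> \<delta> * (1 / 4) ^ k" if "s \<in> {0..\<epsilon>}" for k s
        using contr[OF that c] by simp
      show "summable (\<lambda>k. \<delta> * (1 / 4) ^ k)" by (intro summable_mult summable_geometric) simp
    qed
    moreover have "(\<Sum>k<m. X (Suc k) s c - X k s c) = X m s c" for m s
      using sum_lessThan_telescope[of "\<lambda>k. X k s c" m] by (simp add: X0)
    ultimately show ?thesis by (simp only:)
  qed
  have lim: "(\<lambda>k. X k s c) \<longlonglongrightarrow> D s c" if "s \<in> {0..\<epsilon>}" "c \<in> C" for s c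
    using tendsto_uniform_limitI[OF unif[OF that(2)] that(1)] .
  have D_bound: "\<bar>D s c\<bar> \<le> \<delta>" if "s \<in> {0..\<epsilon>}" "c \<in> C" for s c
    using tendsto_rabs[OF lim[OF that]] bound[OF that] by (intro LIMSEQ_le_const2) auto
  have eq: "D s c = s * l c + Q (D s) c" if s: "s \<in> {0..\<epsilon>}" and c: "c \<in> C" for s c
  proof -
    \<comment> \<open>The total error over the finite set \<open>C\<close> dominates every single
      coordinate error and still tends to zero.\<close>
    define \<eta> where "\<eta> k = (\<Sum>a\<in>C. \<bar>X k s a - D s a\<bar>)" for k
    have "\<eta> \<longlonglongrightarrow> (\<Sum>a\<in>C. \<bar>D s a - D s a\<bar>)"
      unfolding \<eta>_def using lim[OF s] by (intro tendsto_intros) auto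
    then have "(\<lambda>k. 1 / 4 * \<eta> k) \<longlonglongrightarrow> 0" using tendsto_mult_right_zero by simp
    moreover have "\<bar>Q (X k s) c - Q (D s) c\<bar> \<le> 1 / 4 * \<eta> k" for k
      unfolding \<delta>(2)[symmetric]
    proof (rule lip[OF c])
      fix a assume "a \<in> C"
      then show "\<bar>X k s a\<bar> \<le> \<delta> \<and> \<bar>D s a\<bar> \<le> \<delta> \<and> \<bar>X k s a - D s a\<bar> \<le> \<eta> k"
        unfolding \<eta>_def using bound[OF s] D_bound[OF s] C
        by (auto intro!: member_le_sum[of a C "\<lambda>a. \<bar>X k s a - D s a\<bar>"])
    qed (use \<delta> in \<open>auto simp: \<eta>_def intro!: sum_nonneg\<close>)
    then have "\<forall>\<^sub>F k in sequentially. norm (Q (X k s) c - Q (D s) c) \<le> 1 / 4 * \<eta> k"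
      by (intro always_eventually) simp
    ultimately have "(\<lambda>k. Q (X k s) c - Q (D s) c) \<longlonglongrightarrow> 0"
      by (rule Lim_null_comparison[rotated])
    then have "(\<lambda>k. Q (X k s) c) \<longlonglongrightarrow> Q (D s) c" by (simp add: LIM_zero_iff)
    then have "(\<lambda>k. X (Suc k) s c) \<longlonglongrightarrow> s * l c + Q (D s) c"
      unfolding XS by (intro tendsto_intros)
    moreover have "(\<lambda>k. X (Suc k) s c) \<longlonglongrightarrow> D s c" using lim[OF s c] by (rule LIMSEQ_Suc)
    ultimately show ?thesis using LIMSEQ_unique by blast
  qed
  have "D 0 c = 0" if "c \<in> C" for c
  proof -
    have "X k 0 c = 0" if "c \<in> C" for k c
      using that
    proof (induction k arbitrary: c)
      case (Suc k)
      have "\<bar>Q (X k 0) c - Q (\<lambda>_. 0) c\<bar> \<le> K * 0 * 0" using Suc by (intro lip) auto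
      then show ?case using Q0 Suc.prems by (simp add: XS)
    qed (simp add: X0)
    then show ?thesis using that unfolding D_def by simp
  qed
  moreover have "continuous_on {0..\<epsilon>} (\<lambda>s. D s c)" if "c \<in> C" for c
    using X_cont[OF that] by (intro uniform_limit_theorem[OF _ unif[OF that]]) auto
  ultimately show thesis using that \<epsilon>(1) eq by blast
qed

text \<open>
  Squared lengths are quadratic in the displacement, so inverting the rigidity matrix turns the
  condition ``increase the squared length of \<open>e0\<close> by \<open>s\<close> and keep all other lengths'' into
  the equation solved by the previous lemma.
\<close>

lemma independent_edge_flexible:
  fixes p :: "nat \<Rightarrow> real ^ 'd::{finite,linorder}"
  assumes E: "E \<subseteq> polygon_edges n"
    and count: "2 * card E + CARD('d) * (CARD('d) + 1) = 2 * (n * CARD('d))"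
    and rigid: "inf_rigid n E p" and e0: "e0 \<in> E"
  shows "flexible_framework {0..<n} (E - {e0}) p"
proof -
  have fin: "finite E" using E finite_polygon_edges finite_subset by blast
  let ?R = "rigidity_rows E :: (nat set + 'd \<times> 'd) set" and ?C = "rigidity_cols n :: (nat \<times> 'd) set"
  let ?M = "rigidity_matrix (edge_vector p) p"
  have finR: "finite ?R" using fin by (rule finite_rigidity_rows)
  have card: "card ?R = card ?C"
    using card_rigidity_rows[OF fin, where 'd = 'd] count unfolding card_rigidity_cols by simp
  have "nonsing ?R ?C ?M"
    using rigid inf_rigid_iff_regular[OF E] unfolding regular_def by blast
  then obtain L where L: "\<And>y r. r \<in> ?R \<Longrightarrow> (\<Sum>c\<in>?C. ?M r c * (\<Sum>r'\<in>?R. L c r' * y r')) = y r"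
    using nonsing_right_inverse[OF finR finite_rigidity_cols card] by blast
  \<comment> \<open>The second-order part of the change of a squared length. Normalising rows are
    imposed linearly, hence the value \<open>0\<close> there.\<close>
  define N where "N r x = (case r of Inl e \<Rightarrow> \<Sum>k\<in>UNIV. (x (Min e, k) - x (Max e, k))\<^sup>2 | Inr _ \<Rightarrow> 0)"
    for r :: "nat set + 'd \<times> 'd" and x :: "nat \<times> 'd \<Rightarrow> real"
  \<comment> \<open>A displacement \<open>d\<close> changes a squared length by twice its linear row
    value plus \<open>N\<close>. Prescribing the change \<open>s\<close> for \<open>e0\<close> and
    \<open>0\<close> elsewhere makes the row values \<open>s / 2 - N / 2\<close> and
    \<open>- N / 2\<close>, whence both halves in \<open>l\<close> and \<open>Q\<close>.\<close>
  define l where "l c = L c (Inl e0) / 2" for c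
  define Q where "Q x c = - (\<Sum>r\<in>?R. L c r * N r x) / 2" for x c
  define B where "B = (\<Sum>c\<in>?C. \<Sum>r\<in>?R. \<bar>L c r\<bar>)"
  \<comment> \<open>Each of the \<open>CARD('d)\<close> squares contributes a Lipschitz factor
    \<open>8\<close>, halved in \<open>Q\<close> and weighted by at most \<open>B\<close>. The
    remaining \<open>B + 1\<close> bounds \<open>l\<close> and makes \<open>K\<close>
    positive.\<close>
  define K where "K = B * (4 * real CARD('d)) + B + 1"
  have e0R: "Inl e0 \<in> ?R" using e0 unfolding rigidity_rows_def by blast
  have endpoints: "(Min e, k) \<in> ?C \<and> (Max e, k) \<in> ?C" if "Inl e \<in> ?R" for e k
  proof -
    have "e \<in> polygon_edges n" using that E unfolding rigidity_rows_def by blast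
    then obtain i j where "e = {i, j}" "i < j" "j < n" by (rule polygon_edgesE)
    then show ?thesis by (auto simp: rigidity_cols_def)
  qed
  have LB: "(\<Sum>r\<in>?R. \<bar>L c r\<bar>) \<le> B" if "c \<in> ?C" for c
    unfolding B_def using that finite_rigidity_cols
    by (intro member_le_sum[of c ?C "\<lambda>c. \<Sum>r\<in>?R. \<bar>L c r\<bar>"]) (auto intro: sum_nonneg)
  have B0: "0 \<le> B" unfolding B_def by (intro sum_nonneg) simp
  have N_lip: "\<bar>N r x - N r y\<bar> \<le> 8 * real CARD('d) * \<delta> * \<eta>"
    if r: "r \<in> ?R" and "0 \<le> \<delta>" "0 \<le> \<eta>"
      and xy: "\<And>a. a \<in> ?C \<Longrightarrow> \<bar>x a\<bar> \<le> \<delta> \<and> \<bar>y a\<bar> \<le> \<delta> \<and> \<bar>x a - y a\<bar> \<le> \<eta>" for r x y and \<delta> \<eta> :: real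
  proof (cases r)
    case (Inl e)
    have summand: "\<bar>(x (Min e, k) - x (Max e, k))\<^sup>2 - (y (Min e, k) - y (Max e, k))\<^sup>2\<bar> \<le> 8 * \<delta> * \<eta>" for k
    proof -
      define a where "a = x (Min e, k) - x (Max e, k)"
      define b where "b = y (Min e, k) - y (Max e, k)"
      have ab: "\<bar>a + b\<bar> \<le> 4 * \<delta>" "\<bar>a - b\<bar> \<le> 2 * \<eta>"
        using xy[of "(Min e, k)", OF endpoints[OF r[unfolded Inl], THEN conjunct1]]
          xy[of "(Max e, k)", OF endpoints[OF r[unfolded Inl], THEN conjunct2]]
        unfolding a_def b_def abs_le_iff by (intro conjI; linarith)+
      have "\<bar>a + b\<bar> * \<bar>a - b\<bar> \<le> (4 * \<delta>) * (2 * \<eta>)"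
        using mult_mono[OF ab] \<open>0 \<le> \<delta>\<close> by simp
      moreover have "\<bar>a\<^sup>2 - b\<^sup>2\<bar> = \<bar>a + b\<bar> * \<bar>a - b\<bar>"
        unfolding abs_mult[symmetric] by (simp add: power2_eq_square algebra_simps)
      ultimately show ?thesis unfolding a_def b_def by simp
    qed
    have "N r x - N r y = (\<Sum>k\<in>UNIV. (x (Min e, k) - x (Max e, k))\<^sup>2 - (y (Min e, k) - y (Max e, k))\<^sup>2)"
      by (simp add: N_def Inl sum_subtractf)
    then have "\<bar>N r x - N r y\<bar> \<le> (\<Sum>k\<in>(UNIV::'d set). 8 * \<delta> * \<eta>)"
      using order_trans[OF sum_abs sum_mono[OF summand]] by simp
    then show ?thesis by (simp add: mult_ac)
  qed (use that in \<open>simp add: N_def\<close>)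
  have lip: "\<bar>Q x c - Q y c\<bar> \<le> K * \<delta> * \<eta>"
    if c: "c \<in> ?C" and nonneg: "0 \<le> \<delta>" "0 \<le> \<eta>"
      and xy: "\<And>a. a \<in> ?C \<Longrightarrow> \<bar>x a\<bar> \<le> \<delta> \<and> \<bar>y a\<bar> \<le> \<delta> \<and> \<bar>x a - y a\<bar> \<le> \<eta>" for x y c and \<delta> \<eta> :: real
  proof -
    have "Q x c - Q y c = - (\<Sum>r\<in>?R. L c r * (N r x - N r y)) / 2"
      unfolding Q_def by (simp add: right_diff_distrib sum_subtractf diff_divide_distrib)
    then have "\<bar>Q x c - Q y c\<bar> = \<bar>\<Sum>r\<in>?R. L c r * (N r x - N r y)\<bar> / 2" by simp
    also have "\<bar>\<Sum>r\<in>?R. L c r * (N r x - N r y)\<bar> \<le> (\<Sum>r\<in>?R. \<bar>L c r\<bar> * (8 * real CARD('d) * \<delta> * \<eta>))"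
      by (rule order_trans[OF sum_abs]) 
        (auto simp: abs_mult intro!: sum_mono mult_left_mono N_lip[OF _ nonneg xy])
    also have "\<dots> = (\<Sum>r\<in>?R. \<bar>L c r\<bar>) * (8 * real CARD('d) * \<delta> * \<eta>)" by (simp add: sum_distrib_right)
    also have "\<dots> \<le> B * (8 * real CARD('d) * \<delta> * \<eta>)"
      using LB[OF c] nonneg by (intro mult_right_mono) auto
    also have "B * (8 * real CARD('d) * \<delta> * \<eta>) / 2 \<le> K * \<delta> * \<eta>"
    proof -
      have "0 \<le> (B + 1) * (\<delta> * \<eta>)" using B0 nonneg by simp
      then show ?thesis unfolding K_def by (simp add: algebra_simps)
    qed
    finally show ?thesis by simp
  qed
  have l: "\<bar>l c\<bar> \<le> K" if "c \<in> ?C" for c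
  proof -
    have "\<bar>L c (Inl e0)\<bar> \<le> (\<Sum>r\<in>?R. \<bar>L c r\<bar>)"
      using e0R finR by (intro member_le_sum) auto
    also have "\<dots> \<le> B" by (rule LB[OF that])
    finally have "\<bar>l c\<bar> \<le> B" unfolding l_def using B0 by simp
    moreover have "B \<le> K" unfolding K_def using B0 by simp
    ultimately show ?thesis by linarith
  qed
  have cont: "continuous_on X (\<lambda>s. Q (x s) c)"
    if "c \<in> ?C" "\<And>a. a \<in> ?C \<Longrightarrow> continuous_on X (\<lambda>s. x s a)" for x :: "real \<Rightarrow> nat \<times> 'd \<Rightarrow> real" and X c
  proof -
    have "continuous_on X (\<lambda>s. N r (x s))" if r: "r \<in> ?R" for r
    proof (cases r)
      case (Inl e)
      have "continuous_on X (\<lambda>s. x s (Min e, k))" "continuous_on X (\<lambda>s. x s (Max e, k))" for k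
        using endpoints[OF r[unfolded Inl], of k] \<open>\<And>a. a \<in> ?C \<Longrightarrow> continuous_on X (\<lambda>s. x s a)\<close> by blast+
      then show ?thesis unfolding N_def Inl sum.case by (intro continuous_intros)
    qed (simp add: N_def)
    then show ?thesis unfolding Q_def by (intro continuous_intros) auto
  qed
  have K: "K > 0" unfolding K_def using B0 by (simp add: add_nonneg_pos)
  have Q0: "Q (\<lambda>_. 0) c = 0" if "c \<in> ?C" for c
    unfolding Q_def N_def by (auto intro!: sum.neutral split: sum.split)
  obtain \<epsilon> D where \<epsilon>: "\<epsilon> > 0" and Dc: "\<And>c. c \<in> ?C \<Longrightarrow> continuous_on {0..\<epsilon>} (\<lambda>s. D s c)"
    and D0: "\<And>c. c \<in> ?C \<Longrightarrow> D 0 c = 0"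
    and D: "\<And>s c. s \<in> {0..\<epsilon>} \<Longrightarrow> c \<in> ?C \<Longrightarrow> D s c = s * l c + Q (D s) c"
    using quadratic_path[where C = ?C and K = K and l = l and Q = Q, OF finite_rigidity_cols K l Q0 lip cont]
    by blast
  have row: "(\<Sum>c\<in>?C. ?M r c * D s c) = (if r = Inl e0 then s / 2 else 0) - N r (D s) / 2"
    if s: "s \<in> {0..\<epsilon>}" and r: "r \<in> ?R" for s r
  proof -
    define y where "y r = (if r = Inl e0 then s / 2 else 0) - N r (D s) / 2" for r
    have "D s c = (\<Sum>r\<in>?R. L c r * y r)" if "c \<in> ?C" for c
    proof -
      have "(\<Sum>r\<in>?R. L c r * y r) =
          (\<Sum>r\<in>?R. if r = Inl e0 then L c r * (s / 2) else 0) - (\<Sum>r\<in>?R. L c r * N r (D s) / 2)"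
        unfolding sum_subtractf[symmetric] y_def by (intro sum.cong) (auto simp: algebra_simps)
      also have "\<dots> = s * l c + Q (D s) c"
        using e0R finR by (simp add: l_def Q_def sum_divide_distrib)
      finally show ?thesis using D[OF s that] by simp
    qed
    then have "(\<Sum>c\<in>?C. ?M r c * D s c) = (\<Sum>c\<in>?C. ?M r c * (\<Sum>r'\<in>?R. L c r' * y r'))"
      by (intro sum.cong) auto
    then show ?thesis using L[OF r] by (simp add: y_def)
  qed
  \<comment> \<open>The path is rescaled to unit time by \<open>s = \<epsilon> * t\<close>.\<close>
  define q where "q t v = p v + (\<chi> k. D (\<epsilon> * t) (v, k))" for t v
  have time: "\<epsilon> * t \<in> {0..\<epsilon>}" if "t \<in> {0..1}" for t
    using that \<epsilon> by (auto simp: mult_left_le)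
  have length: "(dist (q t u) (q t v))\<^sup>2 = (dist (p u) (p v))\<^sup>2 + (if {u, v} = e0 then \<epsilon> * t else 0)"
    if t: "t \<in> {0..1}" and uv: "{u, v} \<in> E" "u < v" for t u v
  proof -
    define d where "d v = (\<chi> k. D (\<epsilon> * t) (v, k))" for v
    have "{u, v} \<in> polygon_edges n" using E uv by blast
    then have v: "v < n" by (simp add: polygon_edge_iff)
    have "Inl {u, v} \<in> ?R" using uv(1) unfolding rigidity_rows_def by blast
    from row[OF time[OF t] this]
    have "(p u - p v) \<bullet> (d u - d v) = (if {u, v} = e0 then \<epsilon> * t / 2 else 0) - N (Inl {u, v}) (D (\<epsilon> * t)) / 2"
      unfolding rigidity_matrix_sum edge_row_sum[OF uv(2) v] edge_vector_pair[OF uv(2)] d_def by simp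
    moreover have "N (Inl {u, v}) (D (\<epsilon> * t)) = (d u - d v) \<bullet> (d u - d v)"
      using uv(2) by (simp add: N_def d_def inner_vec_def power2_eq_square)
    moreover have "(dist (q t u) (q t v))\<^sup>2 =
        (dist (p u) (p v))\<^sup>2 + 2 * ((p u - p v) \<bullet> (d u - d v)) + (d u - d v) \<bullet> (d u - d v)"
    proof -
      have "q t u - q t v = (p u - p v) + (d u - d v)" by (simp add: q_def d_def)
      then show ?thesis
        by (simp add: dist_norm power2_norm_eq_inner inner_add_left inner_add_right inner_commute)
    qed
    ultimately show ?thesis by simp
  qed
  have "framework_motion {0..<n} (E - {e0}) p q"
    unfolding framework_motion_def
  proof (intro conjI ballI impI)
    fix v assume "v \<in> {0..<n}"
    then have v: "(v, k) \<in> ?C" for k by (simp add: rigidity_cols_def)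
    have "continuous_on {0..1} (\<lambda>t. D (\<epsilon> * t) (v, k))" for k
      using time by (intro continuous_on_compose2[OF Dc[OF v]] continuous_intros) auto
    then show "continuous_on {0..1} (\<lambda>t. q t v)"
      unfolding q_def by (intro continuous_intros)
    show "q 0 v = p v" using D0[OF v] by (simp add: q_def Finite_Cartesian_Product.vec_eq_iff)
  next
    fix t u v assume t: "t \<in> {0..1::real}" and uv: "{u, v} \<in> E - {e0}"
    have "{u, v} \<in> polygon_edges n" using E uv by blast
    then have "u \<noteq> v" by (simp add: polygon_edge_iff)
    have "(dist (q t u) (q t v))\<^sup>2 = (dist (p u) (p v))\<^sup>2"
    proof (cases "u < v")
      case True
      then show ?thesis using length[OF t, of u v] uv by simp
    next
      case False
      then show ?thesis using length[OF t, of v u] uv \<open>u \<noteq> v\<close> by (auto simp: insert_commute dist_commute)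
    qed
    then show "dist (q t u) (q t v) = dist (p u) (p v)" by simp
  qed
  \<comment> \<open>At time \<open>1\<close> the squared length of the deleted edge has grown by
    \<open>\<epsilon> > 0\<close>, which no isometry allows.\<close>
  moreover have "\<not> (\<exists>h. euclidean_isometry h \<and> (\<forall>v\<in>{0..<n}. q 1 v = h (p v)))"
  proof
    assume "\<exists>h. euclidean_isometry h \<and> (\<forall>v\<in>{0..<n}. q 1 v = h (p v))"
    then obtain h where h: "euclidean_isometry h" "\<forall>v\<in>{0..<n}. q 1 v = h (p v)" by blast
    have "e0 \<in> polygon_edges n" using E e0 by blast
    then obtain i j where ij: "e0 = {i, j}" "i < j" "j < n" by (rule polygon_edgesE)
    have "dist (q 1 i) (q 1 j) = dist (p i) (p j)"
      using h ij unfolding euclidean_isometry_def by auto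
    then show False using length[of 1 i j] e0 ij \<epsilon> by auto
  qed
  ultimately show ?thesis unfolding rigid_framework_def by fastforce
qed

theorem theorem1p2p6:
  fixes n :: nat and T :: "nat set set"
  assumes "n \<ge> 5"
    and "k_triangulation 2 n T"
  shows "generically_minimally_rigid TYPE(4) {0..<n} T"
proof -
  have T: "T \<subseteq> polygon_edges n" using assms(2) unfolding triangulation_iff by blast
  obtain p0 :: "nat \<Rightarrow> real ^ 4" where p0: "inf_rigid n T p0"
    and card: "card T + 10 = 4 * n"
    using triangulation_rigid_position[OF assms] by blast
  have count: "2 * card T + CARD(4) * (CARD(4) + 1) = 2 * (n * CARD(4))" using card by simp
  have rigid: "inf_rigid n T p" if "generic_embedding {0..<n} p" for p :: "nat \<Rightarrow> real ^ 4"
    by (rule generic_inf_rigid[OF T count p0 that])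
  have span: "affinely_spanning n p" if "generic_embedding {0..<n} p" for p :: "nat \<Rightarrow> real ^ 4"
    using assms(1) that by (intro generic_affinely_spanning) auto
  have "generically_rigid TYPE(4) {0..<n} T"
    unfolding generically_rigid_def
    using inf_rigid_framework[OF T _ count rigid span] assms(1) by simp
  moreover have "generically_flexible TYPE(4) {0..<n} (T - {e})" if "e \<in> T" for e
    unfolding generically_flexible_def
    using independent_edge_flexible[OF T count rigid that] by blast
  ultimately show ?thesis unfolding generically_minimally_rigid_def by blast
qed

end
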